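(* Let $\Omega\subseteq\mathbb{R}^n$ be a bounded open set and let $\mathcal N\subseteq\mathbb{R}^\ell$ be a compact set. Let $j:\mathbb{R}^n\to[0,+\infty]$ be a kernel such that (i) $j(-z)=j(z)$ for all $z\in\mathbb{R}^n$; (ii) $\int_{\mathbb{R}^n}\min\{1,|z|^2\}\,j(z)\,dz<+\infty$; (iii) $j\notin L^1(B_R)$ for every $R>0$. Let $\psi:\mathcal N\times\mathcal N\to[0,+\infty)$ be a function and let $K:\Omega\times\Omega\to[0,+\infty]$ be a measurable kernel satisfying, for some constant $\Lambda\ge 1$, $$\frac1\Lambda|p-q|^2\le\psi(p,q)\le\Lambda|p-q|^2\quad\text{for all }p,q\in\mathcal N,$$ and $$\frac1\Lambda\, j(x-y)\le K(x,y)\quad\text{for a.e. }x,y\in\Omega.$$ Let $\mathcal P_\Omega:L^2(\Omega;\mathcal N)\to\mathbb{R}$ be a functional that is bounded from below and continuous for the strong topology in $L^2$. Then the functional $$\mathcal I_\Omega(m):=\iint_{\Omega\times\Omega}K(x,y)\,\psi(m(x),m(y))\,dx\,dy+\mathcal P_\Omega(m),$$ defined for every $m\in\mathcal X^K(\Omega;\mathcal N)$, admits at least a minimizer in the class $\mathcal X^K(\Omega;\mathcal N)$.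
   Context: $B_R$ is the ball of radius $R$ centered at the origin of $\mathbb{R}^n$. $L^2(\Omega;\mathcal N):=\{m\in L^2(\Omega;\mathbb{R}^\ell): m\in\mathcal N\text{ a.e. in }\Omega\}$, and $$\mathcal X^K(\Omega;\mathcal N):=\Big\{m\in L^2(\Omega;\mathcal N):\iint_{\Omega\times\Omega}K(x,y)|m(x)-m(y)|^2\,dx\,dy<+\infty\Big\}.$$
   Formalization: The function ψ is additionally assumed lower semicontinuous on N×N (the claim fails for some Borel ψ satisfying all the stated bounds), N is assumed nonempty, and the kernel j is taken Lebesgue measurable. *)

theory Defs
  imports "HOL-Analysis.Analysis"
begin

text \<open>
  Elements of the function spaces are represented by functions on the whole space; only their
  values on the domain \<open>\<Omega>\<close>, up to null sets, matter. Measurability is Lebesgue measurability.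
\<close>

definition L2_into ::
  "(real ^ 'n) set \<Rightarrow> (real ^ 'l) set \<Rightarrow> (real ^ 'n \<Rightarrow> real ^ 'l) set"
where
  "L2_into \<Omega> N =
     {m. m \<in> borel_measurable (lebesgue_on \<Omega>) \<and>
         integrable (lebesgue_on \<Omega>) (\<lambda>x. (norm (m x))\<^sup>2) \<and>
         (AE x in lebesgue_on \<Omega>. m x \<in> N)}"

definition L2_dist ::
  "(real ^ 'n) set \<Rightarrow> (real ^ 'n \<Rightarrow> real ^ 'l) \<Rightarrow> (real ^ 'n \<Rightarrow> real ^ 'l) \<Rightarrow> real"
where
  "L2_dist \<Omega> m m' = sqrt (LINT x|lebesgue_on \<Omega>. (norm (m x - m' x))\<^sup>2)"

text \<open>
  Continuity for the strong (norm) topology. As \<open>L2_dist\<close> is only a pseudometric on functions,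
  this also forces \<open>P\<close> to agree on functions that are equal almost everywhere in \<open>\<Omega>\<close>, that is,
  \<open>P\<close> is really a functional on equivalence classes.
\<close>

definition L2_continuous ::
  "(real ^ 'n) set \<Rightarrow> (real ^ 'l) set \<Rightarrow> ((real ^ 'n \<Rightarrow> real ^ 'l) \<Rightarrow> real) \<Rightarrow> bool"
where
  "L2_continuous \<Omega> N P \<longleftrightarrow>
     (\<forall>m\<in>L2_into \<Omega> N. \<forall>e>0. \<exists>d>0. \<forall>m'\<in>L2_into \<Omega> N.
        L2_dist \<Omega> m' m < d \<longrightarrow> \<bar>P m' - P m\<bar> < e)"

text \<open>
  In the next two definitions the double integral is the integral with respect to Lebesgue
  measure on the product space, with the usual convention \<open>\<infinity> \<cdot> 0 = 0\<close>.
\<close>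

definition X_space ::
  "(real ^ 'n \<Rightarrow> real ^ 'n \<Rightarrow> ennreal) \<Rightarrow> (real ^ 'n) set \<Rightarrow> (real ^ 'l) set \<Rightarrow>
   (real ^ 'n \<Rightarrow> real ^ 'l) set"
where
  "X_space K \<Omega> N =
     {m \<in> L2_into \<Omega> N.
        (\<integral>\<^sup>+(x, y). K x y * ennreal ((norm (m x - m y))\<^sup>2) \<partial>lebesgue_on (\<Omega> \<times> \<Omega>)) < \<infinity>}"

definition energy ::
  "(real ^ 'n \<Rightarrow> real ^ 'n \<Rightarrow> ennreal) \<Rightarrow> (real ^ 'l \<Rightarrow> real ^ 'l \<Rightarrow> real) \<Rightarrow>
   ((real ^ 'n \<Rightarrow> real ^ 'l) \<Rightarrow> real) \<Rightarrow> (real ^ 'n) set \<Rightarrow> (real ^ 'n \<Rightarrow> real ^ 'l) \<Rightarrow> ereal"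
where
  "energy K \<psi> P \<Omega> m =
     enn2ereal (\<integral>\<^sup>+(x, y). K x y * ennreal (\<psi> (m x) (m y)) \<partial>lebesgue_on (\<Omega> \<times> \<Omega>)) + ereal (P m)"

definition lower_semicontinuous_on :: "'a::topological_space set \<Rightarrow> ('a \<Rightarrow> real) \<Rightarrow> bool"
where
  "lower_semicontinuous_on S f \<longleftrightarrow> (\<forall>a. openin (top_of_set S) {x \<in> S. a < f x})"

end

theory Submission
  imports Defs "HOL-Library.Diagonal_Subsequence"
begin

text \<open>
  The direct method. Along a minimizing sequence \<open>u\<^sub>k\<close>, which is uniformly bounded since \<open>N\<close> is
  compact, the energies \<open>\<integral>\<integral> j(x - y) |u\<^sub>k(x) - u\<^sub>k(y)|\<^sup>2\<close> are bounded. Pass to a weakly convergent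
  subsequence and put \<open>v = u\<^sub>k - u\<^sub>l\<close>. For a bounded truncation \<open>W\<close> of \<open>j\<close>, integrating
  \<open>W |v(x)|\<^sup>2 \<le> W |v(x) - v(y)|\<^sup>2 + 2 W v(x) \<bullet> v(y)\<close> in \<open>x\<close> and \<open>y\<close>, the first term on the right is bounded
  and the second tends to 0 as \<open>k, l \<rightarrow> \<infinity>\<close>, because the integral operator with kernel \<open>W\<close> turns weak
  into pointwise convergence. On the left, \<open>|v(x)|\<^sup>2\<close> is multiplied by the mass of \<open>W\<close>, which is as large
  as desired because \<open>j\<close> is not integrable at 0. Hence the subsequence is Cauchy in \<open>L\<^sup>2\<close>; the limit is
  a minimizer by Fatou's lemma, the lower semicontinuity of \<open>\<psi>\<close> and the continuity of \<open>P\<close>.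
\<close>

section \<open>Weak compactness of bounded sequences\<close>

text \<open>Finite intersections of members of a countable basis form a countable pi-system.
  Countability serves the diagonal extraction below, stability under intersections serves Dynkin's
  argument. The empty intersection contributes \<open>UNIV\<close>, so that integrals over the whole
  space are among those made to converge.\<close>

lemma countable_Int_stable_generator_borel:
  obtains G :: "'a::second_countable_topology set set"
  where "countable G" "Int_stable G" "UNIV \<in> G" "sets borel = sigma_sets UNIV G"
proof -
  obtain B :: "'a set set" where B: "countable B" "topological_basis B"
    using ex_countable_basis by blast
  define G where "G = Inter ` {F. finite F \<and> F \<subseteq> B}"
  have "countable G"
    unfolding G_def by (intro countable_image countable_Collect_finite_subset B)
  moreover have "Int_stable G"
    unfolding Int_stable_def
  proof safe
    fix a b assume "a \<in> G" "b \<in> G"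
    then obtain F F' where "finite F" "F \<subseteq> B" "a = \<Inter>F" "finite F'" "F' \<subseteq> B" "b = \<Inter>F'"
      by (auto simp: G_def)
    then show "a \<inter> b \<in> G"
      unfolding G_def by (intro image_eqI[of _ _ "F \<union> F'"]) auto
  qed
  moreover have "UNIV \<in> G"
    unfolding G_def by (intro image_eqI[of _ _ "{}"]) auto
  moreover have "sets borel = sigma_sets UNIV G"
  proof -
    have BG: "B \<subseteq> G"
      unfolding G_def by (auto intro!: image_eqI[of _ _ "{_}"])
    have "open a" if "a \<in> G" for a
      using that B(2) unfolding G_def by (auto intro!: open_Inter simp: topological_basis_open)
    moreover have sB: "sets borel = sigma_sets UNIV B"
      by (subst borel_eq_countable_basis[OF B]) simp
    ultimately have "G \<subseteq> sigma_sets UNIV B"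
      using borel_open by blast
    then show ?thesis
      unfolding sB using sigma_sets_eqI[of B UNIV G] BG by (auto intro: sigma_sets.Basic)
  qed
  ultimately show thesis using that by blast
qed

text \<open>Cantor's diagonal argument, each refinement coming from Bolzano-Weierstrass.\<close>

lemma diagonal_convergent_subsequence:
  fixes a :: "nat \<Rightarrow> nat \<Rightarrow> 'b::heine_borel"
  assumes "\<And>i. bounded (range (a i))"
  obtains r where "strict_mono r" "\<And>i. convergent (\<lambda>k. a i (r k))"
proof -
  define Q where "Q i s \<longleftrightarrow> convergent (a i \<circ> s)" for i and s :: "nat \<Rightarrow> nat"
  interpret subseqs Q
  proof
    fix n and s :: "nat \<Rightarrow> nat" assume "strict_mono s"
    have "bounded (range (a n \<circ> s))"
      by (rule bounded_subset[OF assms[of n]]) auto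
    then obtain l r where "strict_mono r" "((a n \<circ> s) \<circ> r) \<longlonglongrightarrow> l"
      using bounded_imp_convergent_subsequence by metis
    then show "\<exists>r. strict_mono r \<and> Q n (s \<circ> r)"
      unfolding Q_def convergent_def by (auto simp: o_assoc)
  qed
  have "convergent (\<lambda>k. a i (diagseq k))" for i
  proof -
    have "Q i (diagseq \<circ> (+) (Suc i))"
    proof (rule diagseq_holds)
      fix r s :: "nat \<Rightarrow> nat" and n assume "strict_mono r" "Q n s"
      then show "Q n (s \<circ> r)"
        unfolding Q_def o_assoc by (rule convergent_subseq_convergent[rotated])
    qed
    \<comment> \<open>The diagonal sequence is known to refine the extraction made for index
      \<open>i\<close> only after its first \<open>Suc i\<close> terms; the shift is removed
      afterwards.\<close>
    then have "convergent (\<lambda>k. a i (diagseq (k + Suc i)))"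
      by (simp add: Q_def o_def add.commute)
    then show ?thesis by (simp only: convergent_ignore_initial_segment[of "\<lambda>k. a i (diagseq k)"])
  qed
  with subseq_diagseq that show thesis by blast
qed

text \<open>Three-term Cauchy estimate. It carries convergence of integrals over to countable unions
  of sets and to L1 limits of test functions.\<close>

lemma convergent_uniform_approx:
  fixes a :: "nat \<Rightarrow> 'b::banach"
  assumes "\<And>e. e > 0 \<Longrightarrow> \<exists>b. convergent b \<and> (\<forall>k. norm (a k - b k) \<le> e)"
  shows "convergent a"
  unfolding Cauchy_convergent_iff[symmetric]
proof (rule metric_CauchyI)
  fix e :: real assume "e > 0"
  with assms[of "e/4"] obtain b where b: "convergent b" "\<And>k. norm (a k - b k) \<le> e/4"
    by auto
  from b(1) have "Cauchy b" by (simp add: Cauchy_convergent_iff)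
  with \<open>e > 0\<close> obtain M where M: "\<And>m n. m \<ge> M \<Longrightarrow> n \<ge> M \<Longrightarrow> dist (b m) (b n) < e/4"
    unfolding Cauchy_def by (meson divide_pos_pos zero_less_numeral)
  have "dist (a m) (a n) < e" if "m \<ge> M" "n \<ge> M" for m n
  proof -
    have "dist (a m) (a n) \<le> dist (a m) (b m) + dist (b m) (b n) + dist (a n) (b n)"
      by metric
    also have "\<dots> < e/4 + e/4 + e/4"
      using b(2)[of m] b(2)[of n] M[OF that] by (simp add: dist_norm)
    finally show ?thesis using \<open>e > 0\<close> by simp
  qed
  then show "\<exists>M. \<forall>m\<ge>M. \<forall>n\<ge>M. dist (a m) (a n) < e" by blast
qed

lemma (in finite_measure) bounded_integrable:
  fixes f :: "'a \<Rightarrow> 'b::{banach, second_countable_topology}"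
  assumes "f \<in> borel_measurable M" "\<And>x. norm (f x) \<le> B"
  shows "integrable M f"
  using assms by (intro integrable_const_bound[of _ B]) auto

lemma (in finite_measure) norm_integral_bounded:
  fixes f :: "'a \<Rightarrow> 'b::{banach, second_countable_topology}"
  assumes "f \<in> borel_measurable M" "\<And>x. norm (f x) \<le> B"
  shows "norm (\<integral>x. f x \<partial>M) \<le> B * measure M (space M)"
proof -
  have "norm (\<integral>x. f x \<partial>M) \<le> (\<integral>x. norm (f x) \<partial>M)" by simp
  also have "\<dots> \<le> (\<integral>x. B \<partial>M)"
    using assms by (intro integral_mono bounded_integrable[of "\<lambda>x. norm (f x)" B]) auto
  finally show ?thesis by (simp add: mult.commute)
qed

text \<open>Sequential weak-star compactness of bounded sets of L-infinity, by hand: a diagonal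
  argument treats the indicators of a countable pi-system, Dynkin's theorem extends convergence to
  all measurable sets, and approximation in L1 extends it to every integrable
  \<open>g\<close>.\<close>

lemma bounded_weakly_convergent_subsequence:
  fixes M :: "'a::second_countable_topology measure"
    and u :: "nat \<Rightarrow> 'a \<Rightarrow> 'b::euclidean_space"
  assumes "finite_measure M" and sets_M: "sets M = sets borel"
    and [measurable]: "\<And>k. u k \<in> borel_measurable M"
    and bound: "\<And>k x. norm (u k x) \<le> B"
  obtains r where "strict_mono r"
    "\<And>g. integrable M g \<Longrightarrow> convergent (\<lambda>k. \<integral>x. g x *\<^sub>R u (r k) x \<partial>M)"
proof -
  interpret finite_measure M by fact
  have space_M: "space M = UNIV" using sets_eq_imp_space_eq[OF sets_M] by simp
  have B: "B \<ge> 0" using bound[of 0 undefined] norm_ge_zero order_trans by blast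
  obtain G :: "'a set set" where G: "countable G" "Int_stable G" "UNIV \<in> G" "sets borel = sigma_sets UNIV G"
    by (rule countable_Int_stable_generator_borel)
  have sets_M': "sets M = sigma_sets UNIV G"
    unfolding sets_M G(4) by simp
  have ind: "norm (indicator A x *\<^sub>R u k x) \<le> B" for A k x
    using bound[of k x] B by (auto simp: indicator_def)
  have bdd: "bounded (range (\<lambda>k. \<integral>x. indicator A x *\<^sub>R u k x \<partial>M))" if [measurable]: "A \<in> sets M" for A
    unfolding bounded_iff using norm_integral_bounded[of "\<lambda>x. indicator A x *\<^sub>R u _ x" B, OF _ ind]
    by (intro exI[of _ "B * measure M (space M)"]) auto
  have GM: "from_nat_into G i \<in> sets M" for i
    using from_nat_into[of G i] G(3) sets_M' by auto
  obtain r where r: "strict_mono r"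
    and conv: "\<And>i. convergent (\<lambda>k. \<integral>x. indicator (from_nat_into G i) x *\<^sub>R u (r k) x \<partial>M)"
    using diagonal_convergent_subsequence[of "\<lambda>i k. \<integral>x. indicator (from_nat_into G i) x *\<^sub>R u k x \<partial>M"]
      bdd[OF GM] by metis
  have convG: "convergent (\<lambda>k. \<integral>x. indicator A x *\<^sub>R u (r k) x \<partial>M)" if "A \<in> G" for A
    using conv[of "to_nat_on G A"] that G(1) by simp
  have intI: "integrable M (\<lambda>x. indicator A x *\<^sub>R u k x)" if [measurable]: "A \<in> sets M" for A k
    by (rule bounded_integrable[OF _ ind]) measurable
  have UG: "UNIV = \<Union>G" using G(3) by auto
  have convA: "convergent (\<lambda>k. \<integral>x. indicator A x *\<^sub>R u (r k) x \<partial>M)" if "A \<in> sets M" for A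
    using G(2) subset_Pow_Union[of G, folded UG] that[unfolded sets_M']
  proof (induction rule: sigma_sets_induct_disjoint)
    case (basic A) then show ?case by (rule convG)
  next
    case empty then show ?case by (simp add: convergent_const)
  next
    case (compl A)
    then have A: "A \<in> sets M" by (simp add: sets_M')
    \<comment> \<open>A complement reduces to the whole space, which belongs to \<open>G\<close>,
      minus the set itself.\<close>
    have "(\<integral>x. indicator (UNIV - A) x *\<^sub>R u (r k) x \<partial>M) =
      (\<integral>x. indicator UNIV x *\<^sub>R u (r k) x \<partial>M) - (\<integral>x. indicator A x *\<^sub>R u (r k) x \<partial>M)" for k
    proof -
      have UM: "UNIV \<in> sets M" using sets.top[of M] by (simp add: space_M)
      show ?thesis
        by (subst Bochner_Integration.integral_diff[symmetric, OF intI[OF UM] intI[OF A]])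
          (intro Bochner_Integration.integral_cong, auto simp: indicator_def)
    qed
    then show ?case using convergent_diff[OF convG[OF G(3)] compl(2)] by simp
  next
    case (union A)
    then have A[measurable]: "\<And>i. A i \<in> sets M" by (auto simp: sets_M')
    show ?case
    proof (rule convergent_uniform_approx)
      fix e :: real assume e: "e > 0"
      have "(\<lambda>n. measure M (\<Union>i<n. A i)) \<longlonglongrightarrow> measure M (\<Union>n. \<Union>i<n. A i)"
        by (intro finite_Lim_measure_incseq) (auto simp: incseq_def, force)
      also have "(\<Union>n. \<Union>i<n. A i) = (\<Union>i. A i)" by auto
      finally have "(\<lambda>n. B * (measure M (\<Union>i. A i) - measure M (\<Union>i<n. A i))) \<longlonglongrightarrow>
          B * (measure M (\<Union>i. A i) - measure M (\<Union>i. A i))"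
        by (intro tendsto_intros)
      then have "\<forall>\<^sub>F n in sequentially. B * (measure M (\<Union>i. A i) - measure M (\<Union>i<n. A i)) < e"
        using e by (intro order_tendstoD) auto
      then obtain n where n: "B * (measure M (\<Union>i. A i) - measure M (\<Union>i<n. A i)) < e"
        by (auto simp: eventually_sequentially)
      \<comment> \<open>Finite partial unions approximate uniformly in \<open>k\<close>: the error
        is at most \<open>B\<close> times the measure of the tail, and \<open>n\<close> was chosen
        to make this small.\<close>
      define b where "b k = (\<integral>x. indicator (\<Union>i<n. A i) x *\<^sub>R u (r k) x \<partial>M)" for k
      have b_eq: "b k = (\<Sum>i<n. \<integral>x. indicator (A i) x *\<^sub>R u (r k) x \<partial>M)" for k
      proof -
        have "disjoint_family_on A {..<n}" using union(1) by (rule disjoint_family_on_mono[rotated]) auto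
        then have "indicator (\<Union>i<n. A i) x *\<^sub>R u (r k) x = (\<Sum>i<n. indicator (A i) x *\<^sub>R u (r k) x)" for x
          by (simp add: indicator_UN_disjoint scaleR_left.sum)
        then show ?thesis unfolding b_def
          by (simp only: Bochner_Integration.integral_sum[OF intI[OF A]])
      qed
      have "convergent b"
        unfolding b_eq using union(3) by (intro convergent_sum) auto
      moreover have "norm ((\<integral>x. indicator (\<Union>i. A i) x *\<^sub>R u (r k) x \<partial>M) - b k) \<le> e" for k
      proof -
        let ?D = "(\<Union>i. A i) - (\<Union>i<n. A i)"
        have "(\<integral>x. indicator (\<Union>i. A i) x *\<^sub>R u (r k) x \<partial>M) - b k = (\<integral>x. indicator ?D x *\<^sub>R u (r k) x \<partial>M)"
          unfolding b_def by (subst Bochner_Integration.integral_diff[symmetric, OF intI intI])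
            (auto intro!: Bochner_Integration.integral_cong simp: indicator_def)
        also have "norm \<dots> \<le> (\<integral>x. norm (indicator ?D x *\<^sub>R u (r k) x) \<partial>M)"
          by (rule integral_norm_bound)
        also have "\<dots> \<le> (\<integral>x. indicator ?D x * B \<partial>M)"
          by (intro integral_mono bounded_integrable[of _ B])
            (use ind bound B in \<open>auto simp: indicator_def\<close>)
        also have "\<dots> = measure M ?D * B"
          by (simp add: space_M)
        also have "measure M ?D = measure M (\<Union>i. A i) - measure M (\<Union>i<n. A i)"
          by (intro finite_measure_Diff) auto
        finally show ?thesis using n by (simp add: mult.commute)
      qed
      ultimately show "\<exists>b. convergent b \<and>
          (\<forall>k. norm ((\<integral>x. indicator (\<Union>i. A i) x *\<^sub>R u (r k) x \<partial>M) - b k) \<le> e)" by blast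
    qed
  qed
  have int: "integrable M (\<lambda>x. g x *\<^sub>R u k x)" if [measurable]: "integrable M g" for g :: "'a \<Rightarrow> real" and k
  proof (rule Bochner_Integration.integrable_bound[of _ "\<lambda>x. B * g x"])
    show "AE x in M. norm (g x *\<^sub>R u k x) \<le> norm (B * g x)"
      using bound[of k] B by (auto simp: abs_mult mult.commute[of B] intro!: mult_left_mono)
  qed (use that in auto)
  have "convergent (\<lambda>k. \<integral>x. g x *\<^sub>R u (r k) x \<partial>M)" if "integrable M g" for g :: "'a \<Rightarrow> real"
    using that
  proof (induction rule: integrable_induct)
    case (base A c)
    have "(\<lambda>k. \<integral>x. (indicator A x *\<^sub>R c) *\<^sub>R u (r k) x \<partial>M) = (\<lambda>k. c *\<^sub>R (\<integral>x. indicator A x *\<^sub>R u (r k) x \<partial>M))"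
      by (subst integral_scaleR_right[symmetric]) (simp add: mult.commute)
    then show ?case
      using convA[OF base(1)] bounded_linear.convergent[OF bounded_linear_scaleR_right[of c]] by simp
  next
    case (add f g)
    then show ?case
      by (simp add: scaleR_add_left int convergent_add)
  next
    case (lim f s)
    show ?case
    proof (rule convergent_uniform_approx)
      fix e :: real assume e: "e > 0"
      have "(\<lambda>i. \<integral>x. norm (f x - s i x) \<partial>M) \<longlonglongrightarrow> (\<integral>x. 0 \<partial>M)"
      \<comment> \<open>The induction rule supplies approximations with
        \<open>norm (s i x) \<le> 2 * norm (f x)\<close>, hence the factor 3.\<close>
      proof (rule integral_dominated_convergence[where w="\<lambda>x. 3 * norm (f x)"])
        show "AE x in M. (\<lambda>i. norm (f x - s i x)) \<longlonglongrightarrow> 0"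
        proof (rule AE_I2)
          fix x assume "x \<in> space M"
          from tendsto_norm[OF tendsto_diff[OF tendsto_const lim.hyps(2)[OF this], of "f x"]]
          show "(\<lambda>i. norm (f x - s i x)) \<longlonglongrightarrow> 0" by simp
        qed
        show "AE x in M. norm (norm (f x - s i x)) \<le> 3 * norm (f x)" for i
        proof (rule AE_I2)
          fix x assume "x \<in> space M"
          from lim.hyps(3)[OF this, of i] show "norm (norm (f x - s i x)) \<le> 3 * norm (f x)"
            using norm_triangle_ineq4[of "f x" "s i x"] by simp
        qed
      qed (use lim.hyps in auto)
      then have "(\<lambda>i. B * (\<integral>x. norm (f x - s i x) \<partial>M)) \<longlonglongrightarrow> B * 0" by (intro tendsto_intros) simp
      then have "\<forall>\<^sub>F i in sequentially. B * (\<integral>x. norm (f x - s i x) \<partial>M) < e"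
        using e by (intro order_tendstoD) auto
      then obtain i where i: "B * (\<integral>x. norm (f x - s i x) \<partial>M) < e"
        by (auto simp: eventually_sequentially)
      have "norm ((\<integral>x. f x *\<^sub>R u (r k) x \<partial>M) - (\<integral>x. s i x *\<^sub>R u (r k) x \<partial>M)) \<le> e" for k
      proof -
        have "(\<integral>x. f x *\<^sub>R u (r k) x \<partial>M) - (\<integral>x. s i x *\<^sub>R u (r k) x \<partial>M) = (\<integral>x. (f x - s i x) *\<^sub>R u (r k) x \<partial>M)"
          by (simp add: scaleR_diff_left int lim.hyps)
        also have "norm \<dots> \<le> (\<integral>x. norm ((f x - s i x) *\<^sub>R u (r k) x) \<partial>M)"
          by (rule integral_norm_bound)
        also have "\<dots> \<le> (\<integral>x. B * norm (f x - s i x) \<partial>M)"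
          by (intro integral_mono integrable_norm int Bochner_Integration.integrable_diff lim.hyps integrable_mult_right)
            (simp add: bound mult.commute[of B] mult_left_mono)
        finally show ?thesis using i by simp
      qed
      with lim.IH[of i] show "\<exists>b. convergent b \<and> (\<forall>k. norm ((\<integral>x. f x *\<^sub>R u (r k) x \<partial>M) - b k) \<le> e)"
        by blast
    qed
  qed
  with r that show thesis by blast
qed

section \<open>Compactness from nonlocal energy bounds\<close>

text \<open>As in the completeness proof of L2: along a fast subsequence the squared increments,
  divided by \<open>\<delta> n\<close>, have integrals summing to a finite value, so the increments
  are summable at almost every point.\<close>

lemma AE_convergent_subsequence:
  fixes u :: "nat \<Rightarrow> 'a \<Rightarrow> 'b::euclidean_space"
  assumes "finite_measure M"
    and [measurable]: "\<And>k. u k \<in> borel_measurable M"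
    and bound: "\<And>k x. norm (u k x) \<le> B"
    and Cauchy: "\<And>e. e > 0 \<Longrightarrow>
      \<exists>n. \<forall>k\<ge>n. \<forall>l\<ge>n. (\<integral>x. (norm (u k x - u l x))\<^sup>2 \<partial>M) < e"
  obtains r v where "strict_mono r" "v \<in> borel_measurable M"
    "AE x in M. (\<lambda>k. u (r k) x) \<longlonglongrightarrow> v x"
proof -
  interpret finite_measure M by fact
  define \<delta> :: "nat \<Rightarrow> real" where "\<delta> n = (1/2) ^ n" for n
  have \<delta>: "\<delta> n > 0" for n by (simp add: \<delta>_def)
  have "\<forall>n. \<exists>m. \<forall>k\<ge>m. \<forall>l\<ge>m. (\<integral>x. (norm (u k x - u l x))\<^sup>2 \<partial>M) < \<delta> n ^ 2"
    by (intro allI Cauchy zero_less_power \<delta>)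
  then obtain m where m: "\<And>n k l. k \<ge> m n \<Longrightarrow> l \<ge> m n \<Longrightarrow>
      (\<integral>x. (norm (u k x - u l x))\<^sup>2 \<partial>M) < \<delta> n ^ 2"
    by metis
  \<comment> \<open>The summand \<open>n\<close> makes \<open>r\<close> strictly increasing, and the
    sum dominates \<open>m n\<close> without any monotonicity of \<open>m\<close>.\<close>
  define r where "r n = n + (\<Sum>i\<le>n. m i)" for n
  have r: "strict_mono r" by (simp add: strict_mono_Suc_iff r_def)
  have rm: "m n \<le> r n" for n
  proof -
    have "m n \<le> (\<Sum>i\<le>n. m i)" by (rule member_le_sum) auto
    then show ?thesis by (simp add: r_def)
  qed
  let ?d = "\<lambda>n x. u (r (Suc n)) x - u (r n) x"
  have int: "integrable M (\<lambda>x. (norm (?d n x))\<^sup>2)" for n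
  proof (rule bounded_integrable[of _ "(2 * B)\<^sup>2"])
    fix x
    have "norm (?d n x) \<le> 2 * B"
      using norm_triangle_ineq4[of "u (r (Suc n)) x" "u (r n) x"] bound[of "r (Suc n)" x] bound[of "r n" x]
      by linarith
    then show "norm ((norm (?d n x))\<^sup>2) \<le> (2 * B)\<^sup>2"
      by (simp only: real_norm_def abs_power2) (rule power_mono, simp_all)
  qed simp
  have le: "(\<integral>\<^sup>+x. ennreal ((norm (?d n x))\<^sup>2 / \<delta> n) \<partial>M) \<le> ennreal (\<delta> n)" for n
  proof -
    have "(\<integral>\<^sup>+x. ennreal ((norm (?d n x))\<^sup>2 / \<delta> n) \<partial>M) = ennreal ((\<integral>x. (norm (?d n x))\<^sup>2 \<partial>M) / \<delta> n)"
      using \<delta>[of n] int[of n] by (subst nn_integral_eq_integral) auto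
    also have "\<dots> \<le> ennreal (\<delta> n)"
    proof (rule ennreal_leI)
      have "r n \<le> r (Suc n)" using r by (simp add: strict_mono_leD)
      then have "(\<integral>x. (norm (?d n x))\<^sup>2 \<partial>M) < \<delta> n ^ 2"
        using rm[of n] by (intro m) auto
      then show "(\<integral>x. (norm (?d n x))\<^sup>2 \<partial>M) / \<delta> n \<le> \<delta> n"
        using \<delta>[of n] by (simp add: divide_le_eq power2_eq_square)
    qed
    finally show ?thesis .
  qed
  have sum_\<delta>: "summable \<delta>" unfolding \<delta>_def by simp
  have "(\<integral>\<^sup>+x. (\<Sum>n. ennreal ((norm (?d n x))\<^sup>2 / \<delta> n)) \<partial>M) = (\<Sum>n. \<integral>\<^sup>+x. ennreal ((norm (?d n x))\<^sup>2 / \<delta> n) \<partial>M)"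
    by (intro nn_integral_suminf) simp
  also have "\<dots> \<le> (\<Sum>n. ennreal (\<delta> n))" by (intro suminf_le le) auto
  also have "\<dots> < \<infinity>" using sum_\<delta> \<delta> by (subst suminf_ennreal_eq[OF _ summable_sums]) (auto intro: less_imp_le)
  finally have "AE x in M. (\<Sum>n. ennreal ((norm (?d n x))\<^sup>2 / \<delta> n)) \<noteq> \<infinity>"
    by (intro nn_integral_noteq_infinite) auto
  then have conv: "AE x in M. convergent (\<lambda>n. u (r n) x)"
  proof eventually_elim
    fix x assume "(\<Sum>n. ennreal ((norm (?d n x))\<^sup>2 / \<delta> n)) \<noteq> \<infinity>"
    then have s: "summable (\<lambda>n. (norm (?d n x))\<^sup>2 / \<delta> n)"
      by (intro summable_suminf_not_top) (auto intro!: divide_nonneg_pos \<delta>)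
    have "summable (\<lambda>n. ?d n x)"
    proof (rule summable_comparison_test'[OF summable_add[OF s sum_\<delta>], of 0])
      fix n
      \<comment> \<open>An arithmetic-geometric inequality trades the square for a first power, at
        the price of the summable term \<open>\<delta> n\<close>.\<close>
      have "0 \<le> (norm (?d n x) - \<delta> n)\<^sup>2 + (norm (?d n x))\<^sup>2 + (\<delta> n)\<^sup>2" by simp
      then have "norm (?d n x) * \<delta> n \<le> (norm (?d n x))\<^sup>2 + (\<delta> n)\<^sup>2"
        by (simp add: power2_diff)
      then show "norm (?d n x) \<le> (norm (?d n x))\<^sup>2 / \<delta> n + \<delta> n"
        using \<delta>[of n] by (simp add: field_simps power2_eq_square)
    qed
    then show "convergent (\<lambda>n. u (r n) x)"
      by (simp add: summable_iff_convergent sum_lessThan_telescope[of "\<lambda>n. u (r n) x"]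
          convergent_diff_const_right_iff)
  qed
  define v where "v x = lim (\<lambda>n. u (r n) x)" for x
  have "v \<in> borel_measurable M"
    unfolding v_def by measurable
  moreover from conv have "AE x in M. (\<lambda>k. u (r k) x) \<longlonglongrightarrow> v x"
    by eventually_elim (simp add: v_def convergent_LIMSEQ_iff)
  ultimately show thesis using that r by blast
qed

text \<open>The two sides differ by \<open>(norm b)\<^sup>2\<close>.\<close>

lemma inner_le_norm_diff_square:
  fixes a b :: "'b::real_inner"
  shows "(norm a)\<^sup>2 \<le> (norm (a - b))\<^sup>2 + 2 * (a \<bullet> b)"
  by (simp add: power2_norm_eq_inner inner_diff inner_commute)

text \<open>
  \<open>W\<close> plays the role of a truncation of \<open>j (x - y)\<close> with mass at least \<open>A\<close>, and \<open>D\<close> of the points of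
  the domain far enough from the boundary to see all of this mass.
\<close>

lemma nonlocal_compactness:
  fixes M :: "'a::second_countable_topology measure"
    and u :: "nat \<Rightarrow> 'a \<Rightarrow> 'b::euclidean_space"
  assumes "finite_measure M" and sets_M: "sets M = sets borel"
    and [measurable]: "\<And>k. u k \<in> borel_measurable M"
    and bound: "\<And>k x. norm (u k x) \<le> B"
    and kernels: "\<And>A \<epsilon>. A > 0 \<Longrightarrow> \<epsilon> > 0 \<Longrightarrow> \<exists>W c D.
      (\<lambda>(x, y). W x y) \<in> borel_measurable (M \<Otimes>\<^sub>M M) \<and> (\<forall>x y. 0 \<le> W x y \<and> W x y \<le> c) \<and>
      D \<in> sets M \<and> measure M (space M - D) \<le> \<epsilon> \<and> (\<forall>x\<in>D. A \<le> (\<integral>y. W x y \<partial>M)) \<and>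
      (\<forall>k. (\<integral>\<^sup>+x. \<integral>\<^sup>+y. ennreal (W x y * (norm (u k x - u k y))\<^sup>2) \<partial>M \<partial>M) \<le> ennreal C)"
    and "C \<ge> 0"
  obtains r v where "strict_mono r" "v \<in> borel_measurable M"
    "AE x in M. (\<lambda>k. u (r k) x) \<longlonglongrightarrow> v x"
proof -
  interpret finite_measure M by fact
  have B: "B \<ge> 0" using bound[of 0 undefined] norm_ge_zero order_trans by blast
  obtain r where r: "strict_mono r"
    and weak: "\<And>g. integrable M g \<Longrightarrow> convergent (\<lambda>k. \<integral>x. g x *\<^sub>R u (r k) x \<partial>M)"
    by (rule bounded_weakly_convergent_subsequence[of M u B, OF assms(1-4)]) blast
  define w where "w k = u (r k)" for k
  have wM[measurable]: "w k \<in> borel_measurable M" for k by (simp add: w_def)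
  have wB: "norm (w k x) \<le> B" for k x using bound by (simp add: w_def)
  have wd: "norm (w k x - w l y) \<le> 2 * B" for k l x y
    using norm_triangle_ineq4[of "w k x" "w l y"] wB[of k x] wB[of l y] by linarith
  have wd2: "(norm (w k x - w l y))\<^sup>2 \<le> (2 * B)\<^sup>2" for k l x y
    by (rule power_mono[OF wd]) simp
  have "\<exists>n. \<forall>k\<ge>n. \<forall>l\<ge>n. (\<integral>x. (norm (w k x - w l x))\<^sup>2 \<partial>M) < e" if e: "e > 0" for e
  proof -
    \<comment> \<open>The final estimate is \<open>A * (\<integral>x. (norm (v x))\<^sup>2
      \<partial>M) \<le> 4 * C + 1 + A * (2 * B)\<^sup>2 * \<epsilon>\<close>. With these choices
      the last term is at most a quarter of \<open>A * e = 16 * C + 4\<close>. It matters that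
      \<open>C\<close> does not depend on \<open>A\<close>. The \<open>+ 1\<close> in the
      denominator of \<open>\<epsilon>\<close> covers \<open>B = 0\<close>.\<close>
    define A where "A = (16 * C + 4) / e"
    define \<epsilon> where "\<epsilon> = e / (4 * (2 * B)\<^sup>2 + 1)"
    have A: "A > 0" using e \<open>C \<ge> 0\<close> by (simp add: A_def add_nonneg_pos)
    have \<epsilon>: "\<epsilon> > 0" using e by (simp add: \<epsilon>_def add_nonneg_pos)
    obtain W c D where [measurable]: "(\<lambda>(x, y). W x y) \<in> borel_measurable (M \<Otimes>\<^sub>M M)"
      and W0: "\<And>x y. 0 \<le> W x y" and Wc: "\<And>x y. W x y \<le> c"
      and D[measurable]: "D \<in> sets M" and mD: "measure M (space M - D) \<le> \<epsilon>"
      and WA: "\<And>x. x \<in> D \<Longrightarrow> A \<le> (\<integral>y. W x y \<partial>M)"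
      and WC: "\<And>k. (\<integral>\<^sup>+x. \<integral>\<^sup>+y. ennreal (W x y * (norm (u k x - u k y))\<^sup>2) \<partial>M \<partial>M) \<le> ennreal C"
      using kernels[OF A \<epsilon>] by (elim exE conjE) (rule that, assumption, blast, blast, assumption+, blast, blast)
    have c: "c \<ge> 0" using W0 Wc order_trans by blast
    have [measurable]: "W x \<in> borel_measurable M" for x
      using measurable_Pair2[of "\<lambda>(x, y). W x y" M M borel x] sets_eq_imp_space_eq[OF sets_M] by simp
    have Wint: "integrable M (W x)" for x
      using W0 Wc by (intro bounded_integrable[of _ c]) auto
    \<comment> \<open>Each \<open>W x\<close> is an integrable test function, so weak convergence of
      \<open>w\<close> makes \<open>T k x\<close> converge for every \<open>x\<close>. As
      \<open>T\<close> is bounded, dominated convergence then yields L1 convergence to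
      \<open>S\<close>.\<close>
    define T where "T k x = (\<integral>y. W x y *\<^sub>R w k y \<partial>M)" for k x
    have [measurable]: "T k \<in> borel_measurable M" for k
      unfolding T_def by measurable
    have Wv: "norm (W x y *\<^sub>R w k y) \<le> c * B" for x y k
      using W0[of x y] Wc[of x y] wB[of k y] by (auto intro!: mult_mono c)
    have TB: "norm (T k x) \<le> c * B * measure M (space M)" for k x
      unfolding T_def by (rule norm_integral_bounded[OF _ Wv]) measurable
    have "convergent (\<lambda>k. T k x)" for x
      unfolding T_def w_def by (rule weak[OF Wint])
    then obtain S where S: "\<And>x. (\<lambda>k. T k x) \<longlonglongrightarrow> S x"
      unfolding convergent_def by metis
    have [measurable]: "S \<in> borel_measurable M"
      by (rule borel_measurable_LIMSEQ_metric[OF _ S]) measurable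
    have SB: "norm (S x) \<le> c * B * measure M (space M)" for x
      by (rule LIMSEQ_le_const2[OF tendsto_norm[OF S]]) (use TB in auto)
    define t where "t k = (\<integral>x. norm (T k x - S x) \<partial>M)" for k
    have TS: "norm (T k x - S x) \<le> 2 * (c * B * measure M (space M))" for k x
      using norm_triangle_ineq4[of "T k x" "S x"] TB[of k x] SB[of x] by linarith
    have TSint: "integrable M (\<lambda>x. norm (T k x - S x))" for k
      by (rule bounded_integrable[of _ "2 * (c * B * measure M (space M))"]) (use TS in auto)
    have "t \<longlonglongrightarrow> (\<integral>x. 0 \<partial>M)"
      unfolding t_def
    proof (rule integral_dominated_convergence[where w="\<lambda>x. 2 * (c * B * measure M (space M))"])
      show "AE x in M. (\<lambda>k. norm (T k x - S x)) \<longlonglongrightarrow> 0"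
        using S by (auto intro!: AE_I2 tendsto_norm_zero simp: LIM_zero_iff)
    qed (use TS in auto)
    \<comment> \<open>The error terms \<open>4 * B * t k\<close> and \<open>4 * B * t l\<close> are
      thus each below one half.\<close>
    then have "(\<lambda>k. 8 * B * t k) \<longlonglongrightarrow> 8 * B * 0" by (intro tendsto_intros) simp
    then have "\<forall>\<^sub>F k in sequentially. 8 * B * t k < 1" by (intro order_tendstoD) auto
    then obtain n where n: "\<And>k. k \<ge> n \<Longrightarrow> 8 * B * t k < 1"
      by (auto simp: eventually_sequentially)
    have "(\<integral>x. (norm (w k x - w l x))\<^sup>2 \<partial>M) < e" if kl: "k \<ge> n" "l \<ge> n" for k l
    proof -
      define v where "v x = w k x - w l x" for x
      have [measurable]: "v \<in> borel_measurable M" unfolding v_def by measurable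
      \<comment> \<open>The energy density at \<open>x\<close>. Its integral is at most
        \<open>C\<close> for each \<open>w i\<close>, and \<open>E v\<close> is controlled by
        \<open>E (w k)\<close> and \<open>E (w l)\<close> through the inequality (a + b)^2
        \<open>\<le>\<close> 2a^2 + 2b^2.\<close>
      define E where "E h x = (\<integral>y. W x y * (norm (h x - h y))\<^sup>2 \<partial>M)" for h :: "'a \<Rightarrow> 'b" and x
      have [measurable]: "E h \<in> borel_measurable M" if [measurable]: "h \<in> borel_measurable M" for h
        unfolding E_def by measurable
      have WE: "norm (W x y * (norm (h x - h y))\<^sup>2) \<le> c * (2 * b)\<^sup>2"
        if "\<And>x. norm (h x) \<le> b" for h :: "'a \<Rightarrow> 'b" and x y b
      proof -
        have "norm (h x - h y) \<le> 2 * b"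
          using norm_triangle_ineq4[of "h x" "h y"] that[of x] that[of y] by linarith
        then have "(norm (h x - h y))\<^sup>2 \<le> (2 * b)\<^sup>2" by (rule power_mono) simp
        then show ?thesis using W0[of x y] Wc[of x y] c
          by (auto simp: abs_mult simp del: power_mult_distrib intro!: mult_mono)
      qed
      have EB: "norm (E h x) \<le> c * (2 * b)\<^sup>2 * measure M (space M)"
        if "\<And>x. norm (h x) \<le> b" and [measurable]: "h \<in> borel_measurable M" for h :: "'a \<Rightarrow> 'b" and x b
        unfolding E_def by (rule norm_integral_bounded[OF _ WE[OF that(1)]]) measurable
      have Ei: "integrable M (\<lambda>y. W x y * (norm (h x - h y))\<^sup>2)"
        if "\<And>x. norm (h x) \<le> b" and [measurable]: "h \<in> borel_measurable M" for h :: "'a \<Rightarrow> 'b" and x b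
        by (rule bounded_integrable[OF _ WE[OF that(1)]]) measurable
      have Eint: "integrable M (E h)" if "\<And>x. norm (h x) \<le> b" "h \<in> borel_measurable M" for h b
        using that by (intro bounded_integrable[OF _ EB[OF that]]) auto
      have E0: "E h x \<ge> 0" for h x unfolding E_def by (intro integral_nonneg_AE) (auto simp: W0)
      have EC: "(\<integral>x. E (w i) x \<partial>M) \<le> C" for i
      proof -
        have "ennreal (\<integral>x. E (w i) x \<partial>M) = (\<integral>\<^sup>+x. ennreal (E (w i) x) \<partial>M)"
          by (intro nn_integral_eq_integral[symmetric] Eint[OF wB]) (auto simp: E0)
        also have "\<dots> = (\<integral>\<^sup>+x. \<integral>\<^sup>+y. ennreal (W x y * (norm (w i x - w i y))\<^sup>2) \<partial>M \<partial>M)"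
          unfolding E_def
          by (intro nn_integral_cong nn_integral_eq_integral[symmetric] Ei[OF wB]) (auto simp: W0)
        also have "\<dots> \<le> ennreal C" using WC[of "r i"] by (simp add: w_def)
        finally show ?thesis using \<open>C \<ge> 0\<close> by simp
      qed
      have vB: "norm (v x) \<le> 2 * B" for x unfolding v_def by (rule wd)
      have Wv2: "W x y * (norm (v x - v y))\<^sup>2 \<le>
          2 * (W x y * (norm (w k x - w k y))\<^sup>2) + 2 * (W x y * (norm (w l x - w l y))\<^sup>2)" for x y
      proof -
        have "norm (v x - v y) \<le> norm (w k x - w k y) + norm (w l x - w l y)"
          using norm_triangle_ineq4[of "w k x - w k y" "w l x - w l y"] by (simp add: v_def algebra_simps)
        then have "(norm (v x - v y))\<^sup>2 \<le> (norm (w k x - w k y) + norm (w l x - w l y))\<^sup>2"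
          by (simp add: power_mono)
        also have "\<dots> \<le> 2 * (norm (w k x - w k y))\<^sup>2 + 2 * (norm (w l x - w l y))\<^sup>2"
          using sum_squares_bound[of "norm (w k x - w k y)" "norm (w l x - w l y)"]
          by (simp add: power2_sum)
        finally show ?thesis using W0[of x y] by (auto dest: mult_left_mono[of _ _ "W x y"] simp: algebra_simps)
      qed
      have Ev: "E v x \<le> 2 * E (w k) x + 2 * E (w l) x" for x
      proof -
        have "E v x \<le> (\<integral>y. 2 * (W x y * (norm (w k x - w k y))\<^sup>2) + 2 * (W x y * (norm (w l x - w l y))\<^sup>2) \<partial>M)"
          unfolding E_def[of v]
          by (intro integral_mono Ei[OF vB] Bochner_Integration.integrable_add integrable_mult_right Ei[OF wB] Wv2) auto
        also have "\<dots> = 2 * E (w k) x + 2 * E (w l) x"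
          unfolding E_def
          by (subst Bochner_Integration.integral_add) (auto intro!: integrable_mult_right Ei[OF wB])
        finally show ?thesis .
      qed
      have Tv: "(\<integral>y. W x y *\<^sub>R v y \<partial>M) = T k x - T l x" for x
      proof -
        have i: "integrable M (\<lambda>y. W x y *\<^sub>R w i y)" for i
          by (rule bounded_integrable[OF _ Wv]) measurable
        show ?thesis
          unfolding T_def v_def scaleR_diff_right by (rule Bochner_Integration.integral_diff[OF i i])
      qed
      have Wvi: "integrable M (\<lambda>y. W x y *\<^sub>R v y)" for x
        unfolding v_def scaleR_diff_right
        by (intro Bochner_Integration.integrable_diff bounded_integrable[OF _ Wv]) measurable
      \<comment> \<open>Integrating the inner product inequality against \<open>W x y\<close> in
        \<open>y\<close> turns the cross term into the operator \<open>T\<close>.\<close>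
      have key: "(\<integral>y. W x y \<partial>M) * (norm (v x))\<^sup>2 \<le> E v x + 2 * (v x \<bullet> (T k x - T l x))" for x
      proof -
        have "(\<integral>y. W x y \<partial>M) * (norm (v x))\<^sup>2 = (\<integral>y. W x y * (norm (v x))\<^sup>2 \<partial>M)"
          by simp
        also have "\<dots> \<le> (\<integral>y. W x y * (norm (v x - v y))\<^sup>2 + 2 * (v x \<bullet> (W x y *\<^sub>R v y)) \<partial>M)"
        proof (intro integral_mono Bochner_Integration.integrable_add Ei[OF vB] integrable_mult_right
            integrable_inner_right Wvi integrable_mult_left Wint)
          show "W x y * (norm (v x))\<^sup>2 \<le> W x y * (norm (v x - v y))\<^sup>2 + 2 * (v x \<bullet> (W x y *\<^sub>R v y))" for y
            using mult_left_mono[OF inner_le_norm_diff_square[of "v x" "v y"] W0[of x y]]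
            by (simp add: algebra_simps)
        qed auto
        also have "\<dots> = E v x + 2 * (v x \<bullet> (\<integral>y. W x y *\<^sub>R v y \<partial>M))"
          unfolding E_def
          by (subst Bochner_Integration.integral_add)
            (auto intro!: Ei[OF vB] Wvi simp: integral_inner_right[OF Wvi] simp del: inner_scaleR_right)
        finally show ?thesis by (simp add: Tv)
      qed
      \<comment> \<open>On \<open>D\<close> the mass of \<open>W x\<close> is at least
        \<open>A\<close> and \<open>key\<close> applies; off \<open>D\<close> the crude bound
        \<open>norm (v x) \<le> 2 * B\<close> suffices, since that set has measure at most
        \<open>\<epsilon>\<close>.\<close>
      have "A * (norm (v x))\<^sup>2 \<le> 2 * E (w k) x + 2 * E (w l) x + 4 * B * (norm (T k x - S x) + norm (T l x - S x))
          + A * (2 * B)\<^sup>2 * indicator (space M - D) x" if x: "x \<in> space M" for x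
      proof (cases "x \<in> D")
        case True
        have "v x \<bullet> (T k x - T l x) \<le> norm (v x) * norm (T k x - T l x)"
          by (rule norm_cauchy_schwarz)
        also have "\<dots> \<le> 2 * B * (norm (T k x - S x) + norm (T l x - S x))"
          using norm_triangle_ineq4[of "T k x - S x" "T l x - S x"] by (intro mult_mono vB) (auto simp: B)
        finally have 1: "v x \<bullet> (T k x - T l x) \<le> 2 * B * (norm (T k x - S x) + norm (T l x - S x))" .
        have "A * (norm (v x))\<^sup>2 \<le> (\<integral>y. W x y \<partial>M) * (norm (v x))\<^sup>2"
          using WA[OF True] by (intro mult_right_mono) auto
        with key[of x] Ev[of x] 1 True show ?thesis by (simp add: algebra_simps)
      next
        case False
        have "A * (norm (v x))\<^sup>2 \<le> A * (2 * B)\<^sup>2"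
          using A wd2 by (intro mult_left_mono) (auto simp: v_def)
        moreover have "0 \<le> 2 * E (w k) x + 2 * E (w l) x + 4 * B * (norm (T k x - S x) + norm (T l x - S x))"
          using E0 B by simp
        moreover have "indicator (space M - D) x = (1::real)" using False x by simp
        ultimately show ?thesis by simp
      qed
      then have "(\<integral>x. A * (norm (v x))\<^sup>2 \<partial>M) \<le> (\<integral>x. 2 * E (w k) x + 2 * E (w l) x + 4 * B * (norm (T k x - S x) + norm (T l x - S x))
          + A * (2 * B)\<^sup>2 * indicator (space M - D) x \<partial>M)"
        by (intro integral_mono Bochner_Integration.integrable_add integrable_mult_right Eint[OF wB] TSint
            bounded_integrable[of "\<lambda>x. (norm (v x))\<^sup>2" "(2 * B)\<^sup>2"])
          (auto simp: v_def wd2[simplified] less_top[symmetric])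
      also have "\<dots> = 2 * (\<integral>x. E (w k) x \<partial>M) + 2 * (\<integral>x. E (w l) x \<partial>M) + 4 * B * (t k + t l)
          + A * (2 * B)\<^sup>2 * measure M (space M - D)"
        unfolding t_def
        by (simp add: Eint[OF wB] TSint less_top[symmetric] Int_absorb2)
      also have "\<dots> \<le> 4 * C + 1 + A * (2 * B)\<^sup>2 * \<epsilon>"
      proof -
        have "4 * B * (t k + t l) \<le> 1" using n[OF kl(1)] n[OF kl(2)] by (simp add: algebra_simps)
        moreover have "A * (2 * B)\<^sup>2 * measure M (space M - D) \<le> A * (2 * B)\<^sup>2 * \<epsilon>"
          using mD A by (intro mult_left_mono) auto
        ultimately show ?thesis using EC[of k] EC[of l] by linarith
      qed
      also have "\<dots> < A * e"
      proof -
        have "4 * ((2 * B)\<^sup>2 * \<epsilon>) \<le> e"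
        proof -
          have "(4 * (2 * B)\<^sup>2) * \<epsilon> \<le> (4 * (2 * B)\<^sup>2 + 1) * \<epsilon>" using \<epsilon> by (intro mult_right_mono) auto
          also have "\<dots> = e"
            using add_nonneg_pos[of "4 * (2 * B)\<^sup>2" 1] unfolding \<epsilon>_def by simp
          finally show ?thesis by (simp add: mult.assoc)
        qed
        then have "4 * (A * (2 * B)\<^sup>2 * \<epsilon>) \<le> A * e"
          using A mult_left_mono[of "4 * ((2 * B)\<^sup>2 * \<epsilon>)" e A] by (simp add: algebra_simps)
        moreover have "A * e = 16 * C + 4" using e by (simp add: A_def)
        ultimately show ?thesis using \<open>C \<ge> 0\<close> by linarith
      qed
      finally have "A * (\<integral>x. (norm (v x))\<^sup>2 \<partial>M) < A * e" by simp
      then show ?thesis using A by (simp add: v_def)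
    qed
    then show ?thesis by blast
  qed
  note Cauchy = this
  obtain s v where "strict_mono s" "v \<in> borel_measurable M" "AE x in M. (\<lambda>k. w (s k) x) \<longlonglongrightarrow> v x"
    by (rule AE_convergent_subsequence[of M w B, OF assms(1) wM wB Cauchy])
  then show thesis
    using that[of "r \<circ> s" v] strict_mono_o[OF r, of s] by (simp add: w_def)
qed

section \<open>Lebesgue measure on subsets, products and differences\<close>

lemma nn_integral_lborel_reflect:
  fixes f :: "'a::euclidean_space \<Rightarrow> ennreal"
  assumes [measurable]: "f \<in> borel_measurable borel"
  shows "(\<integral>\<^sup>+y. f (x - y) \<partial>lborel) = (\<integral>\<^sup>+y. f y \<partial>lborel)"
proof -
  have "lborel = distr lborel borel (\<lambda>y. x - y)"
    using lborel_affine[of "-1" x] by (simp add: density_1)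
  then have "(\<integral>\<^sup>+y. f y \<partial>lborel) = (\<integral>\<^sup>+y. f y \<partial>distr lborel borel (\<lambda>y. x - y))"
    by (rule arg_cong)
  then show ?thesis by (simp add: nn_integral_distr)
qed

lemma AE_lebesgue_on_iff:
  assumes "S \<in> sets lebesgue"
  shows "(AE x in lebesgue_on S. P x) \<longleftrightarrow> (AE x in lborel. x \<in> S \<longrightarrow> P x)"
  using assms by (simp add: AE_restrict_space_iff AE_completion_iff)

lemma nn_integral_lebesgue_on:
  assumes "S \<in> sets lebesgue"
  shows "(\<integral>\<^sup>+x. f x \<partial>lebesgue_on S) = (\<integral>\<^sup>+x. f x * indicator S x \<partial>lborel)"
  using assms by (simp add: nn_integral_restrict_space nn_integral_completion)

lemma AE_lborel_Pair:
  fixes P :: "'a::euclidean_space \<Rightarrow> bool" and Q :: "'b::euclidean_space \<Rightarrow> bool"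
  assumes "AE x in lborel. P x" and "AE y in lborel. Q y"
  shows "AE z in lborel. P (fst z) \<and> Q (snd z)"
proof -
  obtain A where A: "A \<in> null_sets lborel" "{x. \<not> P x} \<subseteq> A"
    using assms(1) by (auto simp: eventually_ae_filter)
  obtain B where B: "B \<in> null_sets lborel" "{y. \<not> Q y} \<subseteq> B"
    using assms(2) by (auto simp: eventually_ae_filter)
  have [measurable]: "A \<in> sets borel" "B \<in> sets borel" using A B by (simp_all add: null_sets_def)
  have "A \<times> UNIV \<in> null_sets (lborel \<Otimes>\<^sub>M (lborel :: 'b measure))"
    "UNIV \<times> B \<in> null_sets (lborel \<Otimes>\<^sub>M lborel)"
    using A B by (auto simp: null_sets_def lborel.emeasure_pair_measure_Times)
  from AE_not_in[OF this(1)] AE_not_in[OF this(2)] show ?thesis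
    unfolding lborel_prod by eventually_elim (use A B in auto)
qed

lemma AE_lebesgue_on_Times:
  fixes S :: "'a::euclidean_space set"
  assumes "S \<in> sets borel" and "AE x in lebesgue_on S. P x"
  shows "AE z in lebesgue_on (S \<times> S). P (fst z) \<and> P (snd z)"
proof -
  have "AE x in lborel. x \<in> S \<longrightarrow> P x" using assms by (simp add: AE_lebesgue_on_iff)
  from AE_lborel_Pair[OF this this] show ?thesis
    using assms by (subst AE_lebesgue_on_iff) (auto simp: borel_Times elim: eventually_mono)
qed

text \<open>By Fubini: for fixed \<open>x\<close>, the points \<open>y\<close> with
  \<open>x - y\<close> in a null set \<open>A\<close> form a reflected translate of
  \<open>A\<close>. This allows the kernel to be changed on a null set inside
  \<open>j (x - y)\<close>.\<close>

lemma AE_lborel_diff: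
  fixes P :: "'a::euclidean_space \<Rightarrow> bool"
  assumes "AE z in lborel. P z"
  shows "AE z in lborel. P (fst z - snd z)"
proof -
  obtain A where A: "A \<in> null_sets lborel" "{x. \<not> P x} \<subseteq> A"
    using assms by (auto simp: eventually_ae_filter)
  have [measurable]: "A \<in> sets borel" using A by auto
  have "AE z in lborel \<Otimes>\<^sub>M (lborel :: 'a measure). fst z - snd z \<notin> A"
  proof (rule lborel_pair.AE_pair_measure)
    show "AE x in lborel. AE y in lborel. fst (x, y) - snd (x, y) \<notin> A"
    proof (rule AE_I2)
      fix x :: 'a
      have "(\<integral>\<^sup>+y. indicator A (x - y) \<partial>lborel) = emeasure lborel A"
        using nn_integral_lborel_reflect[of "indicator A" x] by simp
      also have "\<dots> = 0" using A by auto
      finally have "AE y in lborel. indicator A (x - y) = (0::ennreal)"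
        by (subst (asm) nn_integral_0_iff_AE) auto
      then show "AE y in lborel. fst (x, y) - snd (x, y) \<notin> A"
        by eventually_elim (auto simp: indicator_def split: if_splits)
    qed
  qed measurable
  then show ?thesis unfolding lborel_prod by eventually_elim (use A in auto)
qed

text \<open>Provides the kernels for \<open>nonlocal_compactness\<close>: \<open>j (x - y)\<close>
  is cut off at a finite height and to a small ball, where its mass is still arbitrarily large
  because \<open>j\<close> has infinite integral on every ball around 0.\<close>

lemma nonlocal_energy_compactness:
  fixes u :: "nat \<Rightarrow> 'a::euclidean_space \<Rightarrow> 'b::euclidean_space"
  assumes "open \<Omega>" "bounded \<Omega>"
    and [measurable]: "j \<in> borel_measurable borel"
    and sing: "\<And>R. R > 0 \<Longrightarrow> (\<integral>\<^sup>+z. j z * indicator (ball 0 R) z \<partial>lborel) = \<infinity>"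
    and u[measurable]: "\<And>k. u k \<in> borel_measurable borel"
    and bound: "\<And>k x. norm (u k x) \<le> B"
    and energy: "\<And>k. (\<integral>\<^sup>+(x, y). j (x - y) * ennreal ((norm (u k x - u k y))\<^sup>2) * indicator (\<Omega> \<times> \<Omega>) (x, y) \<partial>lborel)
      \<le> ennreal C"
    and "C \<ge> 0"
  obtains r v where "strict_mono r" "v \<in> borel_measurable borel"
    "AE x in lborel. x \<in> \<Omega> \<longrightarrow> (\<lambda>k. u (r k) x) \<longlonglongrightarrow> v x"
proof -
  have [measurable]: "\<Omega> \<in> sets borel" using \<open>open \<Omega>\<close> by simp
  \<comment> \<open>A density on the whole space, instead of a restricted space, keeps the Borel
    sets as sigma-algebra, as the abstract compactness result demands.\<close>
  define M where "M = density (lborel :: 'a measure) (indicator \<Omega>)"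
  have sets_M[measurable_cong]: "sets M = sets borel" by (simp add: M_def)
  have space_M: "space M = UNIV" by (simp add: M_def)
  have emM: "emeasure M A = emeasure lborel (\<Omega> \<inter> A)" if "A \<in> sets borel" for A
    using that by (simp add: M_def emeasure_density_const emeasure_restricted)
  have "emeasure lborel \<Omega> < \<infinity>" using \<open>bounded \<Omega>\<close> by (rule emeasure_bounded_finite)
  then have "finite_measure M" by (intro finite_measureI) (simp add: emM space_M)
  then interpret finite_measure M .
  have nnM: "(\<integral>\<^sup>+x. f x \<partial>M) = (\<integral>\<^sup>+x. indicator \<Omega> x * f x \<partial>lborel)"
    if "f \<in> borel_measurable borel" for f
    unfolding M_def using that by (intro nn_integral_density) auto
  \<comment> \<open>Points whose distance to the complement is at least
    \<open>1 / real (Suc n)\<close>. The sets \<open>- D n\<close> decrease to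
    \<open>- \<Omega>\<close>, which has \<open>M\<close>-measure 0.\<close>
  define D where "D n = {x. 1 / real (Suc n) \<le> infdist x (- \<Omega>)}" for n
  have [measurable]: "D n \<in> sets borel" for n
    unfolding D_def by (intro borel_closed closed_Collect_le continuous_intros)
  \<comment> \<open>By convention \<open>infdist\<close> to the empty set is 0, so characterizing
    the closed set \<open>- \<Omega>\<close> by \<open>infdist\<close> requires a point in
    it.\<close>
  have ne: "- \<Omega> \<noteq> {}" using \<open>bounded \<Omega>\<close> not_bounded_UNIV by (metis double_complement compl_bot_eq)
  have "(\<lambda>n. measure M (- D n)) \<longlonglongrightarrow> measure M (\<Inter>n. - D n)"
  proof (rule finite_Lim_measure_decseq)
    show "decseq (\<lambda>n. - D n)"
      unfolding decseq_def D_def by (auto elim!: order_trans[rotated] intro!: divide_left_mono)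
  qed (auto simp: sets_M)
  moreover have "(\<Inter>n. - D n) = - \<Omega>"
  proof -
    have "infdist x (- \<Omega>) = 0" if "\<And>n. infdist x (- \<Omega>) < 1 / real (Suc n)" for x
      using that infdist_nonneg[of x "- \<Omega>"] by (metis nat_approx_posE less_eq_real_def less_asym)
    moreover have "infdist x (- \<Omega>) = 0 \<longleftrightarrow> x \<in> - \<Omega>" for x
      using in_closed_iff_infdist_zero[of "- \<Omega>" x] ne \<open>open \<Omega>\<close> by (simp add: closed_Compl)
    ultimately show ?thesis by (auto simp: D_def not_le)
  qed
  moreover have "measure M (- \<Omega>) = 0" by (simp add: measure_def emM)
  ultimately have D_lim: "(\<lambda>n. measure M (- D n)) \<longlonglongrightarrow> 0" by simp
  obtain r v where rv: "strict_mono r" "v \<in> borel_measurable M" "AE x in M. (\<lambda>k. u (r k) x) \<longlonglongrightarrow> v x"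
  proof (rule nonlocal_compactness[of M u B C])
    fix A \<epsilon> :: real assume "A > 0" "\<epsilon> > 0"
    from order_tendstoD(2)[OF D_lim \<open>\<epsilon> > 0\<close>] obtain n where n: "measure M (- D n) < \<epsilon>"
      by (auto simp: eventually_sequentially)
    define R where "R = 1 / real (Suc n)"
    have R: "R > 0" by (simp add: R_def)
    \<comment> \<open>The radius \<open>R\<close> is the distance defining \<open>D n\<close>, so
      for \<open>x \<in> D n\<close> the support of \<open>\<lambda>y. w i (x - y)\<close> stays in
      \<open>\<Omega>\<close> and restricting to \<open>\<Omega>\<close> loses no mass.\<close>
    define w where "w i z = min (j z) (of_nat i) * indicator (ball 0 R) z" for i z
    have [measurable]: "ball (0::'a) R \<in> sets borel" by simp
    have [measurable]: "w i \<in> borel_measurable borel" for i unfolding w_def by measurable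
    have "(SUP i. \<integral>\<^sup>+z. w i z \<partial>lborel) = (\<integral>\<^sup>+z. (SUP i. w i z) \<partial>lborel)"
    proof (rule nn_integral_monotone_convergence_SUP[symmetric])
      show "incseq w"
        unfolding incseq_def le_fun_def w_def by (auto intro!: mult_right_mono min.mono)
    qed auto
    also have "(\<lambda>z. SUP i. w i z) = (\<lambda>z. j z * indicator (ball 0 R) z)"
    proof
      fix z
      have "(SUP i. min (j z) (of_nat i)) = j z"
        using inf_SUP[of "j z" "of_nat :: nat \<Rightarrow> ennreal" UNIV] by (simp add: inf_min ennreal_SUP_of_nat_eq_top)
      then show "(SUP i. w i z) = j z * indicator (ball 0 R) z"
        unfolding w_def by (simp flip: SUP_mult_right_ennreal)
    qed
    also have "(\<integral>\<^sup>+z. j z * indicator (ball 0 R) z \<partial>lborel) = \<infinity>" by (rule sing[OF R])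
    finally have "ennreal A < (SUP i. \<integral>\<^sup>+z. w i z \<partial>lborel)"
      by (metis ennreal_less_top infinity_ennreal_def)
    \<comment> \<open>By monotone convergence the masses of the truncations increase to infinity, so
      some height \<open>i\<close> gives mass above \<open>A\<close>.\<close>
    then obtain i where i: "ennreal A < (\<integral>\<^sup>+z. w i z \<partial>lborel)" by (auto simp: less_SUP_iff)
    have w_le: "w i z \<le> of_nat i" for z by (auto simp: w_def indicator_def)
    have w_fin: "w i z < top" for z
      using w_le[of z] by (rule le_less_trans) (simp add: less_top[symmetric])
    define W where "W x y = enn2real (w i (x - y))" for x y
    have W: "ennreal (W x y) = w i (x - y)" for x y
      using w_fin by (simp add: W_def)
    have W0: "0 \<le> W x y" for x y by (simp add: W_def)
    have Wi: "W x y \<le> real i" for x y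
      using w_le[of "x - y"] W[of x y] by (metis ennreal_le_iff ennreal_of_nat_eq_real_of_nat of_nat_0_le_iff)
    have Wm[measurable]: "(\<lambda>(x, y). W x y) \<in> borel_measurable (M \<Otimes>\<^sub>M M)" unfolding W_def by measurable
    have [measurable]: "W x \<in> borel_measurable borel" for x unfolding W_def by measurable
    have "A \<le> (\<integral>y. W x y \<partial>M)" if x: "x \<in> D n" for x
    proof -
      have *: "indicator \<Omega> y * w i (x - y) = w i (x - y)" for y
      proof (cases "y \<in> \<Omega>")
        case False
        then have "infdist x (- \<Omega>) \<le> dist x y" by (intro infdist_le) simp
        with x have "x - y \<notin> ball 0 R" by (simp add: D_def R_def dist_norm norm_minus_commute[of y x])
        then show ?thesis by (simp add: w_def)
      qed simp
      have "ennreal A \<le> (\<integral>\<^sup>+y. w i (x - y) \<partial>lborel)"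
        using i by (subst nn_integral_lborel_reflect) auto
      also have "\<dots> = (\<integral>\<^sup>+y. ennreal (W x y) \<partial>M)"
        by (simp add: nnM W *)
      also have "\<dots> = ennreal (\<integral>y. W x y \<partial>M)"
        using W0 Wi by (intro nn_integral_eq_integral bounded_integrable[of _ "real i"]) auto
      finally show ?thesis by (simp add: integral_nonneg_AE W0 ennreal_le_iff)
    qed
    moreover have "(\<integral>\<^sup>+x. \<integral>\<^sup>+y. ennreal (W x y * (norm (u k x - u k y))\<^sup>2) \<partial>M \<partial>M) \<le> ennreal C" for k
    proof -
      have "(\<integral>\<^sup>+x. \<integral>\<^sup>+y. ennreal (W x y * (norm (u k x - u k y))\<^sup>2) \<partial>M \<partial>M) =
        (\<integral>\<^sup>+x. \<integral>\<^sup>+y. indicator \<Omega> x * (indicator \<Omega> y * (w i (x - y) * ennreal ((norm (u k x - u k y))\<^sup>2))) \<partial>lborel \<partial>lborel)"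
        by (simp add: nnM W ennreal_mult W0 nn_integral_cmult)
      also have "\<dots> \<le> (\<integral>\<^sup>+x. \<integral>\<^sup>+y. j (x - y) * ennreal ((norm (u k x - u k y))\<^sup>2) * indicator (\<Omega> \<times> \<Omega>) (x, y) \<partial>lborel \<partial>lborel)"
        by (intro nn_integral_mono) (auto simp: w_def indicator_def intro!: mult_right_mono)
      also have "\<dots> = (\<integral>\<^sup>+(x, y). j (x - y) * ennreal ((norm (u k x - u k y))\<^sup>2) * indicator (\<Omega> \<times> \<Omega>) (x, y) \<partial>(lborel \<Otimes>\<^sub>M lborel))"
        by (subst lborel.nn_integral_fst[symmetric]) auto
      also have "\<dots> \<le> ennreal C" unfolding lborel_prod by (rule energy)
      finally show ?thesis .
    qed
    ultimately show "\<exists>W c D.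
      (\<lambda>(x, y). W x y) \<in> borel_measurable (M \<Otimes>\<^sub>M M) \<and> (\<forall>x y. 0 \<le> W x y \<and> W x y \<le> c) \<and>
      D \<in> sets M \<and> measure M (space M - D) \<le> \<epsilon> \<and> (\<forall>x\<in>D. A \<le> (\<integral>y. W x y \<partial>M)) \<and>
      (\<forall>k. (\<integral>\<^sup>+x. \<integral>\<^sup>+y. ennreal (W x y * (norm (u k x - u k y))\<^sup>2) \<partial>M \<partial>M) \<le> ennreal C)"
      using W0 Wi Wm n by (intro exI[of _ W] exI[of _ "real i"] exI[of _ "D n"])
        (auto simp: space_M Compl_eq_Diff_UNIV)
  qed (use bound \<open>C \<ge> 0\<close> \<open>finite_measure M\<close> sets_M in auto)
  have "v \<in> borel_measurable borel" using rv(2) by (simp add: M_def)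
  moreover have "AE x in lborel. x \<in> \<Omega> \<longrightarrow> (\<lambda>k. u (r k) x) \<longlonglongrightarrow> v x"
    using rv(3) unfolding M_def by (subst (asm) AE_density) (auto simp: indicator_def elim!: eventually_mono)
  ultimately show thesis using that rv(1) by blast
qed

section \<open>The direct method\<close>

lemma borel_measurable_lower_semicontinuous_on:
  assumes "closed S" and lsc: "lower_semicontinuous_on S f"
  shows "(\<lambda>p. if p \<in> S then f p else 0) \<in> borel_measurable borel"
proof (rule borel_measurableI_greater)
  fix a :: real
  obtain T where T: "open T" "{p \<in> S. a < f p} = S \<inter> T"
    using lsc unfolding lower_semicontinuous_on_def openin_open by blast
  have [measurable]: "S \<in> sets borel" "T \<in> sets borel" using T \<open>closed S\<close> by auto
  have "{p \<in> space borel. a < (if p \<in> S then f p else 0)} = (S \<inter> T) \<union> (if a < 0 then - S else {})"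
    \<comment> \<open>Outside \<open>S\<close> the default value is 0, so the whole complement
      enters the superlevel set exactly when \<open>a < 0\<close>.\<close>
    unfolding T(2)[symmetric] by auto
  then show "{p \<in> space borel. a < (if p \<in> S then f p else 0)} \<in> sets borel" by simp
qed

lemma lower_semicontinuous_on_continuous:
  assumes "continuous_on UNIV f"
  shows "lower_semicontinuous_on S f"
  unfolding lower_semicontinuous_on_def openin_open
  by (intro allI exI[of _ "{x. _ < f x}"]) (auto intro!: open_Collect_less assms)

lemma lower_semicontinuous_norm_diff_square:
  "lower_semicontinuous_on S (\<lambda>(p, q). (norm (p - q :: 'a::real_normed_vector))\<^sup>2)"
  by (rule lower_semicontinuous_on_continuous) (simp add: case_prod_beta' continuous_intros)

lemma lower_semicontinuous_on_le_liminf: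
  assumes lsc: "lower_semicontinuous_on S f" and "x \<longlonglongrightarrow> l" "l \<in> S" "\<And>k. x k \<in> S"
  shows "ennreal (f l) \<le> liminf (\<lambda>k. ennreal (f (x k)))"
  unfolding le_Liminf_iff
proof (intro allI impI)
  fix y assume y: "y < ennreal (f l)"
  \<comment> \<open>Being strictly below a finite value, \<open>y\<close> is itself a nonnegative
    real.\<close>
  then obtain a where a: "a \<ge> 0" "y = ennreal a" by (cases y) auto
  with y have "a < f l" by (simp add: ennreal_less_iff)
  obtain T where T: "open T" "{p \<in> S. a < f p} = S \<inter> T"
    using lsc unfolding lower_semicontinuous_on_def openin_open by blast
  with \<open>a < f l\<close> \<open>l \<in> S\<close> have "l \<in> T" by blast
  from topological_tendstoD[OF assms(2) T(1) this] show "\<forall>\<^sub>F k in sequentially. y < ennreal (f (x k))"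
  proof eventually_elim
    fix k assume "x k \<in> T"
    with T(2) assms(4) have "a < f (x k)" by blast
    then show "y < ennreal (f (x k))" using a by (simp add: ennreal_less_iff)
  qed
qed

text \<open>The factor may be infinite, as \<open>K\<close> may; then equality can fail: if
  \<open>f k\<close> is positive and tends to 0, an infinite \<open>c\<close> gives 0 on the left
  and infinity on the right.\<close>

lemma mult_liminf_le_liminf_mult:
  fixes f :: "nat \<Rightarrow> ennreal"
  shows "c * liminf f \<le> liminf (\<lambda>k. c * f k)"
  unfolding liminf_SUP_INF SUP_mult_left_ennreal
  by (intro SUP_mono' INF_greatest mult_left_mono INF_lower) auto

text \<open>Since \<open>h\<close> is controlled only on \<open>N \<times> N\<close>, it is replaced
  by its Borel extension by 0. Having \<open>m\<close> Borel with all values in \<open>N\<close>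
  makes the composition unambiguous and Borel on the product.\<close>

lemma borel_measurable_pair_integrand:
  fixes m :: "'a::euclidean_space \<Rightarrow> 'b::euclidean_space" and h :: "'b \<Rightarrow> 'b \<Rightarrow> real"
  assumes K: "(\<lambda>(x, y). K x y) \<in> borel_measurable (lebesgue_on S)"
    and "closed N" and lsc: "lower_semicontinuous_on (N \<times> N) (\<lambda>(p, q). h p q)"
    and m[measurable]: "m \<in> borel_measurable borel" and mN: "\<And>x. m x \<in> N"
  shows "(\<lambda>(x, y). K x y * ennreal (h (m x) (m y))) \<in> borel_measurable (lebesgue_on S)"
proof -
  have [measurable]: "(\<lambda>p. if p \<in> N \<times> N then (\<lambda>(p, q). h p q) p else 0) \<in> borel_measurable borel"
    using borel_measurable_lower_semicontinuous_on[OF closed_Times lsc] \<open>closed N\<close> by simp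
  have "(\<lambda>z. (m (fst z), m (snd z))) \<in> borel \<rightarrow>\<^sub>M borel"
    unfolding borel_prod[symmetric] by measurable
  then have "(\<lambda>z. h (m (fst z)) (m (snd z))) \<in> borel_measurable borel"
    using measurable_compose[of "\<lambda>z. (m (fst z), m (snd z))" borel borel
      "\<lambda>p. if p \<in> N \<times> N then (\<lambda>(p, q). h p q) p else 0" borel] mN by simp
  then have "(\<lambda>z. h (m (fst z)) (m (snd z))) \<in> borel_measurable (lebesgue_on S)"
    by (intro measurable_restrict_space1 measurable_completion) simp
  then show ?thesis using K by (simp add: case_prod_beta')
qed

text \<open>Serves to compare the energies with densities \<open>\<psi>\<close> and squared
  distance, in both directions. Measurability of the majorant allows the constant to be taken out of
  the integral.\<close>

lemma nn_integral_pair_mono: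
  fixes m :: "'a::euclidean_space \<Rightarrow> 'b::euclidean_space" and h h' :: "'b \<Rightarrow> 'b \<Rightarrow> real"
  assumes K: "(\<lambda>(x, y). K x y) \<in> borel_measurable (lebesgue_on S)"
    and "closed N" and lsc: "lower_semicontinuous_on (N \<times> N) (\<lambda>(p, q). h' p q)"
    and m: "m \<in> borel_measurable borel" and mN: "\<And>x. m x \<in> N"
    and le: "\<And>p q. p \<in> N \<Longrightarrow> q \<in> N \<Longrightarrow> h p q \<le> c * h' p q" and "c \<ge> 0"
  shows "(\<integral>\<^sup>+(x, y). K x y * ennreal (h (m x) (m y)) \<partial>lebesgue_on S) \<le>
    ennreal c * (\<integral>\<^sup>+(x, y). K x y * ennreal (h' (m x) (m y)) \<partial>lebesgue_on S)"
proof -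
  have "(\<integral>\<^sup>+(x, y). K x y * ennreal (h (m x) (m y)) \<partial>lebesgue_on S) \<le>
      (\<integral>\<^sup>+z. ennreal c * (case z of (x, y) \<Rightarrow> K x y * ennreal (h' (m x) (m y))) \<partial>lebesgue_on S)"
  proof (rule nn_integral_mono, clarsimp)
    fix x y
    have "ennreal (h (m x) (m y)) \<le> ennreal c * ennreal (h' (m x) (m y))"
      using le[OF mN mN, of x y] \<open>c \<ge> 0\<close> by (simp add: ennreal_leI flip: ennreal_mult')
    from mult_left_mono[OF this, of "K x y"]
    show "K x y * ennreal (h (m x) (m y)) \<le> ennreal c * (K x y * ennreal (h' (m x) (m y)))"
      by (simp add: mult_ac)
  qed
  also have "\<dots> = ennreal c * (\<integral>\<^sup>+(x, y). K x y * ennreal (h' (m x) (m y)) \<partial>lebesgue_on S)"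
    by (rule nn_integral_cmult[OF borel_measurable_pair_integrand[OF assms(1-5)]])
  finally show ?thesis .
qed

lemma nn_integral_pair_cong_AE:
  assumes "S \<in> sets borel" and "AE x in lebesgue_on S. m x = m' x"
  shows "(\<integral>\<^sup>+(x, y). K x y * ennreal (h (m x) (m y)) \<partial>lebesgue_on (S \<times> S)) =
    (\<integral>\<^sup>+(x, y). K x y * ennreal (h (m' x) (m' y)) \<partial>lebesgue_on (S \<times> S))"
  using AE_lebesgue_on_Times[OF assms]
  by (intro nn_integral_cong_AE) (auto simp: case_prod_beta' elim: eventually_mono)

text \<open>Fatou's lemma on \<open>S \<times> S\<close>: convergence almost everywhere in
  \<open>S\<close> gives convergence of the pairs almost everywhere in the product, where
  \<open>h\<close> is lower semicontinuous.\<close>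

lemma nonlocal_energy_liminf:
  fixes u :: "nat \<Rightarrow> 'a::euclidean_space \<Rightarrow> 'b::euclidean_space" and h :: "'b \<Rightarrow> 'b \<Rightarrow> real"
  assumes K: "(\<lambda>(x, y). K x y) \<in> borel_measurable (lebesgue_on (S \<times> S))" and "S \<in> sets borel"
    and "closed N" and lsc: "lower_semicontinuous_on (N \<times> N) (\<lambda>(p, q). h p q)"
    and u: "\<And>k. u k \<in> borel_measurable borel" "\<And>k x. u k x \<in> N"
    and v: "\<And>x. v x \<in> N"
    and conv: "AE x in lebesgue_on S. (\<lambda>k. u k x) \<longlonglongrightarrow> v x"
  shows "(\<integral>\<^sup>+(x, y). K x y * ennreal (h (v x) (v y)) \<partial>lebesgue_on (S \<times> S)) \<le>
    liminf (\<lambda>k. \<integral>\<^sup>+(x, y). K x y * ennreal (h (u k x) (u k y)) \<partial>lebesgue_on (S \<times> S))"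
proof -
  have "(\<integral>\<^sup>+(x, y). K x y * ennreal (h (v x) (v y)) \<partial>lebesgue_on (S \<times> S)) \<le>
    (\<integral>\<^sup>+z. liminf (\<lambda>k. case z of (x, y) \<Rightarrow> K x y * ennreal (h (u k x) (u k y))) \<partial>lebesgue_on (S \<times> S))"
  proof (rule nn_integral_mono_AE)
    show "AE z in lebesgue_on (S \<times> S). (case z of (x, y) \<Rightarrow> K x y * ennreal (h (v x) (v y))) \<le>
        liminf (\<lambda>k. case z of (x, y) \<Rightarrow> K x y * ennreal (h (u k x) (u k y)))"
      using AE_lebesgue_on_Times[OF \<open>S \<in> sets borel\<close> conv]
    proof eventually_elim
      fix z
      assume z: "(\<lambda>k. u k (fst z)) \<longlonglongrightarrow> v (fst z) \<and> (\<lambda>k. u k (snd z)) \<longlonglongrightarrow> v (snd z)"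
      obtain x y where xy: "z = (x, y)" by (cases z)
      have "(\<lambda>k. (u k x, u k y)) \<longlonglongrightarrow> (v x, v y)" using z xy by (intro tendsto_Pair) auto
      from lower_semicontinuous_on_le_liminf[OF lsc this] u(2) v
      have "ennreal (h (v x) (v y)) \<le> liminf (\<lambda>k. ennreal (h (u k x) (u k y)))" by simp
      from mult_left_mono[OF this, of "K x y"] mult_liminf_le_liminf_mult[of "K x y"]
      show "(case z of (x, y) \<Rightarrow> K x y * ennreal (h (v x) (v y))) \<le>
          liminf (\<lambda>k. case z of (x, y) \<Rightarrow> K x y * ennreal (h (u k x) (u k y)))"
        unfolding xy by (auto intro: order_trans)
    qed
  qed
  also have "\<dots> \<le> liminf (\<lambda>k. \<integral>\<^sup>+(x, y). K x y * ennreal (h (u k x) (u k y)) \<partial>lebesgue_on (S \<times> S))"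
    by (intro nn_integral_liminf borel_measurable_pair_integrand[OF K \<open>closed N\<close> lsc u])
  finally show ?thesis .
qed

text \<open>The extension by 0 outside \<open>S\<close> has a Borel version in each coordinate.
  Where the assembled function leaves \<open>N\<close>, it is reset to the point \<open>p\<close>;
  within \<open>S\<close> this happens only on a null set.\<close>

lemma borel_representative:
  fixes m :: "'a::euclidean_space \<Rightarrow> 'b::euclidean_space"
  assumes S: "S \<in> sets lebesgue" and m: "m \<in> borel_measurable (lebesgue_on S)"
    and "closed N" "p \<in> N" and mN: "AE x in lebesgue_on S. m x \<in> N"
  obtains m' where "m' \<in> borel_measurable borel" "\<And>x. m' x \<in> N" "AE x in lebesgue_on S. m x = m' x"
proof -
  have g: "(\<lambda>x. if x \<in> S then m x else 0) \<in> borel_measurable lebesgue"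
    using borel_measurable_if[OF S, of m] m by simp
  have "\<exists>g'\<in>borel_measurable lborel. AE x in lborel. (if x \<in> S then m x else 0) \<bullet> b = g' x" for b
    by (rule completion_ex_borel_measurable_real) (use g in measurable)
  then obtain g' where g'[measurable]: "\<And>b. g' b \<in> borel_measurable borel"
    and eq: "\<And>b. AE x in lborel. (if x \<in> S then m x else 0) \<bullet> b = g' b x"
    by (simp, metis)
  define f where "f x = (\<Sum>b\<in>Basis. g' b x *\<^sub>R b)" for x
  have [measurable]: "f \<in> borel_measurable borel" unfolding f_def by measurable
  have [measurable]: "N \<in> sets borel" using \<open>closed N\<close> by simp
  have "AE x in lborel. \<forall>b\<in>Basis. (if x \<in> S then m x else 0) \<bullet> b = g' b x"
    by (intro AE_finite_allI finite_Basis eq)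
  then have "AE x in lborel. x \<in> S \<longrightarrow> m x = f x"
  proof eventually_elim
    fix x assume *: "\<forall>b\<in>Basis. (if x \<in> S then m x else 0) \<bullet> b = g' b x"
    show "x \<in> S \<longrightarrow> m x = f x"
    proof
      assume "x \<in> S"
      then have "f x = (\<Sum>b\<in>Basis. (m x \<bullet> b) *\<^sub>R b)" unfolding f_def using * by (intro sum.cong) auto
      then show "m x = f x" by (simp add: euclidean_representation)
    qed
  qed
  then have "AE x in lebesgue_on S. m x = (if f x \<in> N then f x else p)"
    using mN unfolding AE_lebesgue_on_iff[OF S] by eventually_elim auto
  moreover have "(\<lambda>x. if f x \<in> N then f x else p) \<in> borel_measurable borel" by measurable
  ultimately show thesis using \<open>p \<in> N\<close> by (intro that[of "\<lambda>x. if f x \<in> N then f x else p"]) auto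
qed

section \<open>Membership, distance and continuity in L2\<close>

lemma L2_into_borelI:
  fixes m :: "real ^ 'n \<Rightarrow> real ^ 'l"
  assumes "open \<Omega>" "bounded \<Omega>" "bounded N" and m: "m \<in> borel_measurable borel" and mN: "\<And>x. m x \<in> N"
  shows "m \<in> L2_into \<Omega> N"
proof -
  have "emeasure lebesgue \<Omega> < \<infinity>"
    using emeasure_bounded_finite[OF \<open>bounded \<Omega>\<close>] \<open>open \<Omega>\<close> by simp
  then have fin: "finite_measure (lebesgue_on \<Omega>)"
    using \<open>open \<Omega>\<close> by (intro finite_measureI) (simp add: emeasure_restrict_space)
  obtain B where B: "\<And>p. p \<in> N \<Longrightarrow> norm p \<le> B" using \<open>bounded N\<close> by (auto simp: bounded_iff)
  have mm[measurable]: "m \<in> borel_measurable (lebesgue_on \<Omega>)"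
    using m by (intro measurable_restrict_space1 measurable_completion) simp
  have "integrable (lebesgue_on \<Omega>) (\<lambda>x. (norm (m x))\<^sup>2)"
  proof (rule finite_measure.bounded_integrable[OF fin, of _ "B\<^sup>2"])
    show "norm ((norm (m x))\<^sup>2) \<le> B\<^sup>2" for x using B[OF mN[of x]] by (simp add: power_mono)
  qed measurable
  with mm mN show ?thesis by (simp add: L2_into_def)
qed

lemma L2_dist_eq_0:
  assumes "AE x in lebesgue_on \<Omega>. m x = m' x"
  shows "L2_dist \<Omega> m m' = 0"
proof -
  have "(\<integral>x. (norm (m x - m' x))\<^sup>2 \<partial>lebesgue_on \<Omega>) = 0"
    by (rule integral_eq_zero_AE) (use assms in \<open>auto elim!: eventually_mono\<close>)
  then show ?thesis by (simp add: L2_dist_def)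
qed

text \<open>Functions equal almost everywhere are at distance 0, below every \<open>d\<close> in the
  definition of continuity.\<close>

lemma L2_continuous_cong_AE:
  assumes "L2_continuous \<Omega> N P" "m \<in> L2_into \<Omega> N" "m' \<in> L2_into \<Omega> N" "AE x in lebesgue_on \<Omega>. m x = m' x"
  shows "P m = P m'"
proof -
  have "\<bar>P m - P m'\<bar> < e" if "e > 0" for e
    using assms(1-3) L2_dist_eq_0[OF assms(4)] that unfolding L2_continuous_def by (metis order_less_irrefl)
  from this[of "\<bar>P m - P m'\<bar>"] show ?thesis by fastforce
qed

text \<open>Dominated convergence, the constant majorant coming from the diameter of
  \<open>N\<close>.\<close>

lemma L2_dist_tendsto_0:
  fixes u :: "nat \<Rightarrow> real ^ 'n \<Rightarrow> real ^ 'l"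
  assumes "open \<Omega>" "bounded \<Omega>" "bounded N"
    and u: "\<And>k. u k \<in> borel_measurable borel" "\<And>k x. u k x \<in> N"
    and v: "v \<in> borel_measurable borel" "\<And>x. v x \<in> N"
    and conv: "AE x in lebesgue_on \<Omega>. (\<lambda>k. u k x) \<longlonglongrightarrow> v x"
  shows "(\<lambda>k. L2_dist \<Omega> (u k) v) \<longlonglongrightarrow> 0"
proof -
  have "emeasure lebesgue \<Omega> < \<infinity>"
    using emeasure_bounded_finite[OF \<open>bounded \<Omega>\<close>] \<open>open \<Omega>\<close> by simp
  then interpret finite_measure "lebesgue_on \<Omega>"
    using \<open>open \<Omega>\<close> by (intro finite_measureI) (simp add: emeasure_restrict_space)
  obtain B where B: "\<And>p q. p \<in> N \<Longrightarrow> q \<in> N \<Longrightarrow> norm (p - q) \<le> B"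
    using diameter_bounded_bound[OF \<open>bounded N\<close>] by (metis dist_norm)
  have [measurable]: "u k \<in> borel_measurable (lebesgue_on \<Omega>)" "v \<in> borel_measurable (lebesgue_on \<Omega>)" for k
    using u v by (auto intro!: measurable_restrict_space1 measurable_completion)
  have "(\<lambda>k. \<integral>x. (norm (u k x - v x))\<^sup>2 \<partial>lebesgue_on \<Omega>) \<longlonglongrightarrow> (\<integral>x. 0 \<partial>lebesgue_on \<Omega>)"
  proof (rule integral_dominated_convergence[where w="\<lambda>_. B\<^sup>2"])
    show "AE x in lebesgue_on \<Omega>. (\<lambda>k. (norm (u k x - v x))\<^sup>2) \<longlonglongrightarrow> 0"
      using conv
    proof eventually_elim
      fix x assume "(\<lambda>k. u k x) \<longlonglongrightarrow> v x"
      then have "(\<lambda>k. (norm (u k x - v x))\<^sup>2) \<longlonglongrightarrow> (norm (v x - v x))\<^sup>2"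
        by (intro tendsto_intros)
      then show "(\<lambda>k. (norm (u k x - v x))\<^sup>2) \<longlonglongrightarrow> 0" by simp
    qed
    show "AE x in lebesgue_on \<Omega>. norm ((norm (u k x - v x))\<^sup>2) \<le> B\<^sup>2" for k
      using B[OF u(2) v(2)] by (intro AE_I2) (simp add: power_mono)
  qed auto
  from tendsto_real_sqrt[OF this] show ?thesis by (simp add: L2_dist_def)
qed

theorem theorem2p5:
  fixes \<Omega> :: "(real ^ 'n) set"
    and N :: "(real ^ 'l) set"
    and j :: "real ^ 'n \<Rightarrow> ennreal"
    and \<psi> :: "real ^ 'l \<Rightarrow> real ^ 'l \<Rightarrow> real"
    and K :: "real ^ 'n \<Rightarrow> real ^ 'n \<Rightarrow> ennreal"
    and \<Lambda> :: real
    and P :: "(real ^ 'n \<Rightarrow> real ^ 'l) \<Rightarrow> real"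
  assumes "open \<Omega>" and "bounded \<Omega>"
    and "compact N" and "N \<noteq> {}"
    and "j \<in> borel_measurable lebesgue"
    and "\<forall>z. j (- z) = j z"
    and "(\<integral>\<^sup>+z. ennreal (min 1 ((norm z)\<^sup>2)) * j z \<partial>lebesgue) < \<infinity>"
    and "\<forall>R>0. \<not> (\<integral>\<^sup>+z. j z \<partial>lebesgue_on (ball 0 R)) < \<infinity>"
    and "\<forall>p\<in>N. \<forall>q\<in>N. 0 \<le> \<psi> p q"
    and "lower_semicontinuous_on (N \<times> N) (\<lambda>(p, q). \<psi> p q)"
    and "(\<lambda>(x, y). K x y) \<in> borel_measurable (lebesgue_on (\<Omega> \<times> \<Omega>))"
    and "\<Lambda> \<ge> 1"
    and "\<forall>p\<in>N. \<forall>q\<in>N. 1 / \<Lambda> * (norm (p - q))\<^sup>2 \<le> \<psi> p q \<and> \<psi> p q \<le> \<Lambda> * (norm (p - q))\<^sup>2"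
    and "AE (x, y) in lebesgue_on (\<Omega> \<times> \<Omega>). ennreal (1 / \<Lambda>) * j (x - y) \<le> K x y"
    and "\<exists>c. \<forall>m\<in>L2_into \<Omega> N. c \<le> P m"
    and "L2_continuous \<Omega> N P"
  shows "\<exists>m\<in>X_space K \<Omega> N. \<forall>m'\<in>X_space K \<Omega> N. energy K \<psi> P \<Omega> m \<le> energy K \<psi> P \<Omega> m'"
proof -
  note \<Omega> = assms(1,2) and K = assms(11) and lsc = assms(10) and Pcont = assms(16)
  have cN: "closed N" and bN: "bounded N" using assms(3) by (auto simp: compact_imp_closed compact_imp_bounded)
  have \<Omega>b[measurable]: "\<Omega> \<in> sets borel" and \<Omega>l: "\<Omega> \<in> sets lebesgue" using \<Omega> by auto
  have \<Omega>\<Omega>: "\<Omega> \<times> \<Omega> \<in> sets borel" "\<Omega> \<times> \<Omega> \<in> sets lebesgue" using \<Omega> by (auto intro!: borel_open open_Times)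
  obtain p0 where p0: "p0 \<in> N" using assms(4) by blast
  obtain c where c: "\<And>m. m \<in> L2_into \<Omega> N \<Longrightarrow> c \<le> P m" using assms(15) by blast
  have \<Lambda>: "\<Lambda> > 0" using assms(12) by simp
  \<comment> \<open>Used with \<open>h = \<psi>\<close> for the energy and with \<open>h = s\<close>
    for the finiteness condition defining the class.\<close>
  define Q where "Q h m = (\<integral>\<^sup>+(x, y). K x y * ennreal (h (m x) (m y)) \<partial>lebesgue_on (\<Omega> \<times> \<Omega>))"
    for h :: "real ^ 'l \<Rightarrow> real ^ 'l \<Rightarrow> real" and m
  define s where "s p q = (norm (p - q))\<^sup>2" for p q :: "real ^ 'l"
  have lsc_s: "lower_semicontinuous_on (N \<times> N) (\<lambda>(p, q). s p q)"
    unfolding s_def by (rule lower_semicontinuous_norm_diff_square)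
  \<comment> \<open>Representatives that are Borel and take values in \<open>N\<close> everywhere,
    as the integrand lemmas require.\<close>
  define BN where "BN = {m :: real ^ 'n \<Rightarrow> real ^ 'l. m \<in> borel_measurable borel \<and> (\<forall>x. m x \<in> N)}"
  have BN_L2: "m \<in> L2_into \<Omega> N" if "m \<in> BN" for m
    using that L2_into_borelI[OF \<Omega> bN, of m] by (auto simp: BN_def)
  have X_iff: "m \<in> X_space K \<Omega> N \<longleftrightarrow> m \<in> L2_into \<Omega> N \<and> Q s m < \<infinity>" for m
    by (simp add: X_space_def Q_def s_def)
  have Q\<psi>_le: "Q \<psi> m \<le> ennreal \<Lambda> * Q s m" if "m \<in> BN" for m
    unfolding Q_def using that assms(13) \<Lambda>
    by (intro nn_integral_pair_mono[OF K cN lsc_s]) (auto simp: BN_def s_def)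
  have Qs_le: "Q s m \<le> ennreal \<Lambda> * Q \<psi> m" if "m \<in> BN" for m
    unfolding Q_def
  proof (intro nn_integral_pair_mono[OF K cN lsc])
    fix p q assume "p \<in> N" "q \<in> N"
    with assms(13) have "1 / \<Lambda> * (norm (p - q))\<^sup>2 \<le> \<psi> p q" by blast
    then show "s p q \<le> \<Lambda> * \<psi> p q" using \<Lambda> by (simp add: s_def field_simps)
  qed (use that \<Lambda> in \<open>auto simp: BN_def\<close>)
  have Q_cong: "Q h m = Q h m'" if "AE x in lebesgue_on \<Omega>. m x = m' x" for h m m'
    unfolding Q_def by (rule nn_integral_pair_cong_AE[OF \<Omega>b that])
  \<comment> \<open>Every competitor can be traded for one in \<open>BN\<close> with the same
    energy, so a minimizing sequence may be taken in \<open>BN\<close>.\<close>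
  have rep: "\<exists>m'\<in>BN. m' \<in> X_space K \<Omega> N \<and> Q \<psi> m' = Q \<psi> m \<and> P m' = P m" if mX: "m \<in> X_space K \<Omega> N" for m
  proof -
    have m: "m \<in> L2_into \<Omega> N" using mX by (simp add: X_iff)
    obtain m' where m': "m' \<in> borel_measurable borel" "\<And>x. m' x \<in> N" "AE x in lebesgue_on \<Omega>. m x = m' x"
      using borel_representative[OF \<Omega>l _ cN p0, of m] m unfolding L2_into_def by blast
    have BN: "m' \<in> BN" using m' by (simp add: BN_def)
    show ?thesis
      using BN Q_cong[OF m'(3)] mX m BN_L2[OF BN] L2_continuous_cong_AE[OF Pcont m BN_L2[OF BN] m'(3)]
      by (intro bexI[of _ m']) (auto simp: X_iff)
  qed
  have Q\<psi>_fin: "Q \<psi> m < \<infinity>" if "m \<in> X_space K \<Omega> N" for m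
  proof -
    obtain m' where m': "m' \<in> BN" "m' \<in> X_space K \<Omega> N" "Q \<psi> m' = Q \<psi> m" using rep[OF \<open>m \<in> _\<close>] by blast
    have "Q \<psi> m' \<le> ennreal \<Lambda> * Q s m'" by (rule Q\<psi>_le[OF m'(1)])
    also have "\<dots> < \<infinity>" using m'(2) by (simp add: X_iff ennreal_mult_less_top)
    finally show ?thesis by (simp add: m')
  qed
  define F where "F m = enn2real (Q \<psi> m) + P m" for m
  have energy_eq: "energy K \<psi> P \<Omega> m = ereal (F m)" if "m \<in> X_space K \<Omega> N" for m
  proof -
    have "Q \<psi> m = ennreal (enn2real (Q \<psi> m))" using Q\<psi>_fin[OF that] by simp
    then have "enn2ereal (Q \<psi> m) = ereal (enn2real (Q \<psi> m))"
      by (metis enn2ereal_ennreal enn2real_nonneg)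
    then show ?thesis by (simp add: energy_def F_def Q_def)
  qed
  define X where "X = X_space K \<Omega> N"
  have F_lower: "c \<le> F m" if "m \<in> X" for m
    using c[of m] that enn2real_nonneg[of "Q \<psi> m"] by (auto simp: F_def X_def X_iff simp del: enn2real_nonneg)
  \<comment> \<open>A constant map has zero nonlocal energy, even where \<open>K\<close> is
    infinite, so the class is nonempty.\<close>
  have "(\<lambda>x. p0) \<in> BN" using p0 by (simp add: BN_def)
  moreover have "Q s (\<lambda>x. p0) = 0" by (simp add: Q_def s_def case_prod_beta')
  ultimately have "(\<lambda>x. p0) \<in> X" using BN_L2 by (simp add: X_def X_iff)
  then have Xne: "X \<noteq> {}" by blast
  define \<alpha> where "\<alpha> = Inf (F ` X)"
  have bdd: "bdd_below (F ` X)" using F_lower by (auto intro!: bdd_belowI[of _ c])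
  have \<alpha>_le: "\<alpha> \<le> F m" if "m \<in> X" for m
    unfolding \<alpha>_def using that bdd by (auto intro: cInf_lower)
  have "\<exists>m\<in>BN \<inter> X. F m < \<alpha> + 1 / real (Suc k)" for k
  proof -
    have "Inf (F ` X) < \<alpha> + 1 / real (Suc k)" by (simp add: \<alpha>_def)
    then obtain m where m: "m \<in> X" "F m < \<alpha> + 1 / real (Suc k)"
      using cInf_lessD[of "F ` X"] Xne by blast
    from rep[of m] m(1) obtain m' where "m' \<in> BN" "m' \<in> X" "F m' = F m"
      unfolding X_def F_def by metis
    then show ?thesis using m by (intro bexI[of _ m']) auto
  qed
  then obtain u where u: "\<And>k. u k \<in> BN" "\<And>k. u k \<in> X" "\<And>k. F (u k) < \<alpha> + 1 / real (Suc k)"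
    by (metis IntE)
  have um[measurable]: "u k \<in> borel_measurable borel" and uN: "u k x \<in> N" for k x
    using u(1)[of k] by (auto simp: BN_def)
  obtain B where B: "\<And>p. p \<in> N \<Longrightarrow> norm p \<le> B" using bN by (auto simp: bounded_iff)
  have Qu: "Q \<psi> (u k) = ennreal (F (u k) - P (u k))" for k
    using Q\<psi>_fin[of "u k"] u(2)[of k] by (simp add: F_def X_def)
  \<comment> \<open>One factor \<open>\<Lambda>\<close> bounds \<open>j\<close> by \<open>K\<close>,
    the other bounds the squared distance by \<open>\<psi>\<close>; what remains bounds
    \<open>F (u k) - P (u k)\<close>, as \<open>1 / real (Suc k) \<le> 1\<close> and
    \<open>c \<le> P (u k)\<close>.\<close>
  define C where "C = \<Lambda> * (\<Lambda> * (\<alpha> + 1 - c))"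
  have "c \<le> \<alpha>" unfolding \<alpha>_def using Xne F_lower by (auto intro: cInf_greatest)
  then have C: "C \<ge> 0" using \<Lambda> by (simp add: C_def)
  \<comment> \<open>\<open>j\<close> is only Lebesgue measurable; the compactness lemma needs a
    Borel version, whose singularity at 0 and bound by \<open>K\<close> are transferred
    next.\<close>
  obtain j' where j'[measurable]: "j' \<in> borel_measurable borel" and jj': "AE z in lborel. j z = j' z"
    using completion_ex_borel_measurable[OF assms(5)] by auto
  have j'_sing: "(\<integral>\<^sup>+z. j' z * indicator (ball 0 R) z \<partial>lborel) = \<infinity>" if "R > 0" for R
  proof -
    have "(\<integral>\<^sup>+z. j' z * indicator (ball 0 R) z \<partial>lborel) = (\<integral>\<^sup>+z. j z * indicator (ball 0 R) z \<partial>lborel)"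
      by (rule nn_integral_cong_AE) (use jj' in \<open>auto elim!: eventually_mono\<close>)
    then show ?thesis
      using assms(8) that by (simp add: nn_integral_lebesgue_on less_top[symmetric])
  qed
  have j'K: "AE z in lebesgue_on (\<Omega> \<times> \<Omega>). j' (fst z - snd z) \<le> ennreal \<Lambda> * K (fst z) (snd z)"
  proof -
    have "AE z in lebesgue_on (\<Omega> \<times> \<Omega>). j (fst z - snd z) = j' (fst z - snd z)"
      unfolding AE_lebesgue_on_iff[OF \<Omega>\<Omega>(2)] using AE_lborel_diff[OF jj'] by (auto elim!: eventually_mono)
    with assms(14) show ?thesis
    proof eventually_elim
      fix z assume "case z of (x, y) \<Rightarrow> ennreal (1 / \<Lambda>) * j (x - y) \<le> K x y"
        and eq: "j (fst z - snd z) = j' (fst z - snd z)"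
      then have "ennreal \<Lambda> * (ennreal (1 / \<Lambda>) * j' (fst z - snd z)) \<le> ennreal \<Lambda> * K (fst z) (snd z)"
        by (intro mult_left_mono) (auto simp: case_prod_beta')
      moreover have "ennreal \<Lambda> * ennreal (1 / \<Lambda>) = 1"
        using \<Lambda> by (simp flip: ennreal_mult)
      ultimately show "j' (fst z - snd z) \<le> ennreal \<Lambda> * K (fst z) (snd z)"
        by (simp flip: mult.assoc)
    qed
  qed
  have bound: "(\<integral>\<^sup>+(x, y). j' (x - y) * ennreal ((norm (u k x - u k y))\<^sup>2) * indicator (\<Omega> \<times> \<Omega>) (x, y) \<partial>lborel)
      \<le> ennreal C" for k
  proof -
    have "(\<integral>\<^sup>+(x, y). j' (x - y) * ennreal ((norm (u k x - u k y))\<^sup>2) * indicator (\<Omega> \<times> \<Omega>) (x, y) \<partial>lborel)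
      = (\<integral>\<^sup>+z. j' (fst z - snd z) * ennreal (s (u k (fst z)) (u k (snd z))) \<partial>lebesgue_on (\<Omega> \<times> \<Omega>))"
      by (subst nn_integral_lebesgue_on[OF \<Omega>\<Omega>(2)]) (simp add: case_prod_beta' s_def)
    also have "\<dots> \<le> (\<integral>\<^sup>+z. ennreal \<Lambda> * (case z of (x, y) \<Rightarrow> K x y * ennreal (s (u k x) (u k y))) \<partial>lebesgue_on (\<Omega> \<times> \<Omega>))"
      by (rule nn_integral_mono_AE)
        (use j'K in \<open>auto simp: case_prod_beta' mult.assoc[symmetric] elim!: eventually_mono intro!: mult_right_mono\<close>)
    also have "\<dots> = ennreal \<Lambda> * Q s (u k)"
      unfolding Q_def
      by (rule nn_integral_cmult[OF borel_measurable_pair_integrand[OF K cN lsc_s um uN]])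
    also have "\<dots> \<le> ennreal \<Lambda> * (ennreal \<Lambda> * Q \<psi> (u k))"
      by (intro mult_left_mono Qs_le u) simp
    also have "\<dots> \<le> ennreal \<Lambda> * (ennreal \<Lambda> * ennreal (\<alpha> + 1 - c))"
    proof -
      have "F (u k) - P (u k) \<le> \<alpha> + 1 - c"
      proof -
        have "1 / real (Suc k) \<le> 1" by simp
        with u(3)[of k] c[OF BN_L2[OF u(1)[of k]]] show ?thesis by linarith
      qed
      then show ?thesis unfolding Qu by (intro mult_left_mono ennreal_leI) auto
    qed
    also have "\<dots> = ennreal C" using \<Lambda> \<open>c \<le> \<alpha>\<close> by (simp add: C_def ennreal_mult)
    finally show ?thesis .
  qed
  obtain r v0 where r: "strict_mono r" and v0[measurable]: "v0 \<in> borel_measurable borel"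
    and conv0: "AE x in lborel. x \<in> \<Omega> \<longrightarrow> (\<lambda>k. u (r k) x) \<longlonglongrightarrow> v0 x"
    by (rule nonlocal_energy_compactness[OF \<Omega> j' j'_sing um B[OF uN] bound C])
  \<comment> \<open>As \<open>N\<close> is closed, \<open>v0\<close> lies in \<open>N\<close>
    wherever the subsequence converges; elsewhere the value \<open>p0\<close> is substituted to
    obtain a member of \<open>BN\<close>.\<close>
  define v where "v x = (if v0 x \<in> N then v0 x else p0)" for x
  have Nb[measurable]: "N \<in> sets borel" using cN by simp
  have vm: "v \<in> borel_measurable borel" unfolding v_def by measurable
  have vN: "v x \<in> N" for x using p0 by (simp add: v_def)
  have vBN: "v \<in> BN" using vm vN by (simp add: BN_def)
  have conv: "AE x in lebesgue_on \<Omega>. (\<lambda>k. u (r k) x) \<longlonglongrightarrow> v x"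
    unfolding AE_lebesgue_on_iff[OF \<Omega>l] using conv0
  proof eventually_elim
    fix x assume *: "x \<in> \<Omega> \<longrightarrow> (\<lambda>k. u (r k) x) \<longlonglongrightarrow> v0 x"
    show "x \<in> \<Omega> \<longrightarrow> (\<lambda>k. u (r k) x) \<longlonglongrightarrow> v x"
    proof
      assume "x \<in> \<Omega>"
      with * have l: "(\<lambda>k. u (r k) x) \<longlonglongrightarrow> v0 x" by blast
      then have "v0 x \<in> N" using closed_sequentially[OF cN _ l] uN by blast
      with l show "(\<lambda>k. u (r k) x) \<longlonglongrightarrow> v x" by (simp add: v_def)
    qed
  qed
  have P_lim: "(\<lambda>k. P (u (r k))) \<longlonglongrightarrow> P v"
  proof (rule LIMSEQ_I)
    fix e :: real assume "e > 0"
    then obtain d where d: "d > 0" "\<And>m'. m' \<in> L2_into \<Omega> N \<Longrightarrow> L2_dist \<Omega> m' v < d \<Longrightarrow> \<bar>P m' - P v\<bar> < e"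
      using Pcont BN_L2[OF vBN] unfolding L2_continuous_def by blast
    have "(\<lambda>k. L2_dist \<Omega> (u (r k)) v) \<longlonglongrightarrow> 0"
      by (rule L2_dist_tendsto_0[OF \<Omega> bN um uN vm vN conv])
    from order_tendstoD(2)[OF this d(1)]
    obtain n0 where "\<And>n. n \<ge> n0 \<Longrightarrow> L2_dist \<Omega> (u (r n)) v < d"
      by (auto simp: eventually_sequentially)
    then show "\<exists>n0. \<forall>n\<ge>n0. norm (P (u (r n)) - P v) < e"
      using d(2)[OF BN_L2[OF u(1)]] by (intro exI[of _ n0]) simp
  qed
  \<comment> \<open>Moving the convergent term \<open>P\<close> to the other side leaves only the
    nonlocal energy in the lower limit.\<close>
  have lim_\<alpha>: "(\<lambda>k. \<alpha> + 1 / real (Suc (r k)) - P (u (r k))) \<longlonglongrightarrow> \<alpha> - P v"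
  proof -
    have "(\<lambda>k. 1 / real (Suc (r k))) \<longlonglongrightarrow> 0"
      using LIMSEQ_subseq_LIMSEQ[OF LIMSEQ_Suc[OF lim_1_over_n] r] by (simp add: o_def)
    from tendsto_diff[OF tendsto_add[OF tendsto_const this] P_lim] show ?thesis by simp
  qed
  have "Q \<psi> v \<le> liminf (\<lambda>k. Q \<psi> (u (r k)))"
    unfolding Q_def by (rule nonlocal_energy_liminf[OF K \<Omega>b cN lsc um uN vN conv])
  also have "\<dots> \<le> liminf (\<lambda>k. ennreal (\<alpha> + 1 / real (Suc (r k)) - P (u (r k))))"
    unfolding Qu using u(3) by (intro Liminf_mono always_eventually allI ennreal_leI) (auto intro: less_imp_le)
  also have "\<dots> = ennreal (\<alpha> - P v)"
    by (intro lim_imp_Liminf tendsto_ennrealI lim_\<alpha>) simp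
  finally have Qv: "Q \<psi> v \<le> ennreal (\<alpha> - P v)" .
  \<comment> \<open>\<open>ennreal\<close> truncates negative reals to 0, so the bound on
    \<open>Q \<psi> v\<close> yields \<open>F v \<le> \<alpha>\<close> only once this sign is
    known.\<close>
  have "0 \<le> \<alpha> - P v"
  proof (rule LIMSEQ_le_const[OF lim_\<alpha>], intro exI allI impI)
    fix k
    show "0 \<le> \<alpha> + 1 / real (Suc (r k)) - P (u (r k))"
      using u(3)[of "r k"] enn2real_nonneg[of "Q \<psi> (u (r k))"] unfolding F_def by linarith
  qed
  have "Q s v \<le> ennreal \<Lambda> * Q \<psi> v" by (rule Qs_le[OF vBN])
  also have "\<dots> < \<infinity>" using Qv by (simp add: ennreal_mult_less_top) (metis ennreal_less_top le_less_trans)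
  finally have vX: "v \<in> X" using BN_L2[OF vBN] by (simp add: X_def X_iff)
  have "F v \<le> \<alpha>"
    using enn2real_mono[OF Qv] \<open>0 \<le> \<alpha> - P v\<close> by (simp add: F_def)
  then show ?thesis
    using vX \<alpha>_le energy_eq unfolding X_def by (intro bexI[of _ v]) force+
qed

end
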